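(* Let $(X,Y)$ and $(V,W)$ be two interpolation pairs of Banach lattices such that $\text{P-Int}(X,Y) = \text{P-Int}(V,W)$. Then $(X,Y) \simeq (V,W)$; that is, either $X \simeq V$ and $Y \simeq W$, or $X \simeq W$ and $Y \simeq V$.
   Context: For a Banach lattice $E$, $\|\cdot\|_E$ denotes its norm and $E^+$ its cone of positive elements. A linear operator $T: E \to E$ is called positive if $T(E^+) \subset E^+$; $L^+(E)$ denotes the set of all positive linear operators in $E$ (such operators are automatically bounded), and $\|T\|_{E \to E}$ denotes the operator norm of a bounded linear operator in $E$. For Banach lattices $E$ and $F$, the notation $E \hookrightarrow F$ means that $E$ is an (order) ideal in $F$ and there is a constant $c>0$ such that $\|x\|_F \le c\|x\|_E$ for all $x \in E$. Two Banach lattices $X$ and $Y$ form an interpolation pair $(X,Y)$ of Banach lattices if both are ideals in a certain vector lattice $U$ which is a Hausdorff topological vector space such that the embeddings of $X$ and of $Y$ into $U$ are continuous. To such a pair are canonically associated the Banach lattices $X \cap Y$, with norm $\max\{\|x\|_X, \|x\|_Y\}$, and $X+Y$, with norm $\|z\|_{X+Y} = \inf\{\|x\|_X + \|y\|_Y : z = x+y,\ x \in X,\ y \in Y\}$. $L^+((X,Y))$ denotes the set of all linear operators $T$ in $X+Y$ with $T|_X \in L^+(X)$ and $T|_Y \in L^+(Y)$ (in particular $T(X)\subset X$ and $T(Y)\subset Y$). A Banach lattice $Z$ is called intermediate for $(X,Y)$ if $X \cap Y \hookrightarrow Z \hookrightarrow X+Y$. For a constant $c \ge 1$, $\text{P-Int}_c(X,Y)$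 is the collection of all intermediate Banach lattices $Z$ for $(X,Y)$ such that for every $T \in L^+((X,Y))$ one has $T(Z) \subset Z$ and $\|T\|_{Z \to Z} \le c \max\{\|T\|_{X \to X}, \|T\|_{Y \to Y}\}$. Set $\text{P-Int}(X,Y) = \bigcup_{c \ge 1} \text{P-Int}_c(X,Y)$. For Banach lattices $E$ and $F$, $E \simeq F$ means that $E$ and $F$ coincide as vector lattices and their norms are equivalent. *)

theory Defs
  imports "HOL-Analysis.Analysis" "HOL-Algebra.Module" "HOL-Algebra.Lattice"
begin

text \<open>
  Vector lattices are real ones.  They are structures with an explicit carrier, so that one
  Banach lattice can be an ideal of another, and so that two interpolation pairs need not share
  an ambient vector lattice.  Operations of a structure are meaningful only on its carrier; the
  inherited fields \<open>mult\<close> and \<open>one\<close> of the record \<open>module\<close> are never used.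
\<close>

record 'a vlat = "(real, 'a) module" +
  vle :: "['a, 'a] \<Rightarrow> bool" (infixl \<open>\<preceq>\<index>\<close> 50)

record 'a blat = "'a vlat" +
  vnorm :: "'a \<Rightarrow> real" (\<open>\<parallel>_\<parallel>\<index>\<close>)

definition real_ring :: "real ring" where
  "real_ring = \<lparr>carrier = UNIV, mult = (*), one = 1, zero = 0, add = (+)\<rparr>"

definition vorder :: "('a, 'm) vlat_scheme \<Rightarrow> 'a gorder" where
  "vorder E = \<lparr>carrier = carrier E, eq = (=), le = vle E\<rparr>"

definition vabs :: "('a, 'm) vlat_scheme \<Rightarrow> 'a \<Rightarrow> 'a" where
  "vabs E x = x \<squnion>\<^bsub>vorder E\<^esub> (\<ominus>\<^bsub>E\<^esub> x)"

definition pos_cone :: "('a, 'm) vlat_scheme \<Rightarrow> 'a set" where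
  "pos_cone E = {x \<in> carrier E. \<zero>\<^bsub>E\<^esub> \<preceq>\<^bsub>E\<^esub> x}"

locale vector_lattice =
  Module.module real_ring E + order: Lattice.lattice "vorder E" for E (structure) +
  assumes add_mono:
      "\<lbrakk>x \<in> carrier E; y \<in> carrier E; z \<in> carrier E; x \<preceq> y\<rbrakk> \<Longrightarrow> x \<oplus> z \<preceq> y \<oplus> z"
    and smult_mono:
      "\<lbrakk>x \<in> carrier E; y \<in> carrier E; 0 \<le> a; x \<preceq> y\<rbrakk> \<Longrightarrow> a \<odot> x \<preceq> a \<odot> y"

text \<open>
  The locale \<open>Metric_space\<close> asks for nonnegativity and symmetry also outside the carrier, hence
  the case distinction.
\<close>

definition vdist :: "('a, 'm) blat_scheme \<Rightarrow> 'a \<Rightarrow> 'a \<Rightarrow> real" where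
  "vdist E x y = (if x \<in> carrier E \<and> y \<in> carrier E then \<parallel>x \<ominus>\<^bsub>E\<^esub> y\<parallel>\<^bsub>E\<^esub> else 0)"

locale banach_lattice = vector_lattice E for E (structure) +
  assumes norm_nonneg: "x \<in> carrier E \<Longrightarrow> 0 \<le> \<parallel>x\<parallel>"
    and norm_eq_zero: "x \<in> carrier E \<Longrightarrow> \<parallel>x\<parallel> = 0 \<longleftrightarrow> x = \<zero>"
    and norm_smult: "x \<in> carrier E \<Longrightarrow> \<parallel>a \<odot> x\<parallel> = \<bar>a\<bar> * \<parallel>x\<parallel>"
    and norm_triangle: "\<lbrakk>x \<in> carrier E; y \<in> carrier E\<rbrakk> \<Longrightarrow> \<parallel>x \<oplus> y\<parallel> \<le> \<parallel>x\<parallel> + \<parallel>y\<parallel>"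
    and norm_mono: "\<lbrakk>x \<in> carrier E; y \<in> carrier E; vabs E x \<preceq> vabs E y\<rbrakk> \<Longrightarrow> \<parallel>x\<parallel> \<le> \<parallel>y\<parallel>"
    and complete: "Metric_space.mcomplete (carrier E) (vdist E)"

lemma (in banach_lattice) Metric_space_vdist: "Metric_space (carrier E) (vdist E)"
proof
  have one: "- 1 \<in> carrier real_ring" by (simp add: real_ring_def)
  have neg: "\<ominus>\<^bsub>real_ring\<^esub> (1::real) = - 1"
    using R.minus_equality[of "- 1" 1] by (simp add: real_ring_def)
  have m1: "(- 1) \<odot> x = \<ominus> x" if "x \<in> carrier E" for x
    using smult_l_minus[of 1 x] smult_one[OF that] that neg by (simp add: real_ring_def)
  fix x y z
  show "0 \<le> vdist E x y"
    by (simp add: vdist_def norm_nonneg)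
  show "vdist E x y = vdist E y x"
  proof (cases "x \<in> carrier E \<and> y \<in> carrier E")
    case True
    then have "y \<ominus> x = (- 1) \<odot> (x \<ominus> y)"
      by (simp add: m1 M.minus_eq M.minus_add M.a_comm)
    then show ?thesis
      using True norm_smult[of "x \<ominus> y" "- 1"] by (simp add: vdist_def)
  qed (auto simp: vdist_def)
  assume xy: "x \<in> carrier E" "y \<in> carrier E"
  show "vdist E x y = 0 \<longleftrightarrow> x = y"
    using xy norm_eq_zero[of "x \<ominus> y"] M.r_neg[of y] M.minus_equality[of x "\<ominus> y"]
    by (auto simp: vdist_def M.minus_eq)
  assume z: "z \<in> carrier E"
  have "x \<ominus> z = (x \<ominus> y) \<oplus> (y \<ominus> z)"
    using xy z by (simp add: M.minus_eq M.a_assoc M.r_neg1 M.r_neg2)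
  then show "vdist E x z \<le> vdist E x y + vdist E y z"
    using xy z norm_triangle[of "x \<ominus> y" "y \<ominus> z"] by (simp add: vdist_def)
qed

definition norm_topology :: "('a, 'm) blat_scheme \<Rightarrow> 'a topology" where
  "norm_topology E = Metric_space.mtopology (carrier E) (vdist E)"

definition same_ops :: "('a, 'm) vlat_scheme \<Rightarrow> ('a, 'n) vlat_scheme \<Rightarrow> bool" where
  "same_ops E F \<longleftrightarrow> \<zero>\<^bsub>E\<^esub> = \<zero>\<^bsub>F\<^esub> \<and>
     (\<forall>x\<in>carrier E. \<forall>y\<in>carrier E. x \<oplus>\<^bsub>E\<^esub> y = x \<oplus>\<^bsub>F\<^esub> y) \<and>
     (\<forall>a. \<forall>x\<in>carrier E. a \<odot>\<^bsub>E\<^esub> x = a \<odot>\<^bsub>F\<^esub> x) \<and>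
     (\<forall>x\<in>carrier E. \<forall>y\<in>carrier E. x \<preceq>\<^bsub>E\<^esub> y \<longleftrightarrow> x \<preceq>\<^bsub>F\<^esub> y)"

definition order_ideal :: "('a, 'm) vlat_scheme \<Rightarrow> ('a, 'n) vlat_scheme \<Rightarrow> bool" where
  "order_ideal E F \<longleftrightarrow> submodule (carrier E) real_ring F \<and> same_ops E F \<and>
     (\<forall>x\<in>carrier E. \<forall>y\<in>carrier F. vabs F y \<preceq>\<^bsub>F\<^esub> vabs F x \<longrightarrow> y \<in> carrier E)"

definition embeds :: "('a, 'm) blat_scheme \<Rightarrow> ('a, 'n) blat_scheme \<Rightarrow> bool"
    (infix \<open>\<hookrightarrow>\<close> 50) where
  "E \<hookrightarrow> F \<longleftrightarrow> order_ideal E F \<and> (\<exists>c>0. \<forall>x\<in>carrier E. \<parallel>x\<parallel>\<^bsub>F\<^esub> \<le> c * \<parallel>x\<parallel>\<^bsub>E\<^esub>)"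

definition lattice_equiv :: "('a, 'm) blat_scheme \<Rightarrow> ('a, 'n) blat_scheme \<Rightarrow> bool"
    (infix \<open>\<simeq>\<^sub>L\<close> 50) where
  "E \<simeq>\<^sub>L F \<longleftrightarrow> carrier E = carrier F \<and> same_ops E F \<and>
     (\<exists>a>0. \<exists>b>0. \<forall>x\<in>carrier E. a * \<parallel>x\<parallel>\<^bsub>E\<^esub> \<le> \<parallel>x\<parallel>\<^bsub>F\<^esub> \<and> \<parallel>x\<parallel>\<^bsub>F\<^esub> \<le> b * \<parallel>x\<parallel>\<^bsub>E\<^esub>)"

definition hausdorff_tvs :: "('a, 'm) vlat_scheme \<Rightarrow> 'a topology \<Rightarrow> bool" where
  "hausdorff_tvs U \<tau> \<longleftrightarrow> topspace \<tau> = carrier U \<and> Hausdorff_space \<tau> \<and>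
     continuous_map (prod_topology \<tau> \<tau>) \<tau> (\<lambda>(x, y). x \<oplus>\<^bsub>U\<^esub> y) \<and>
     continuous_map (prod_topology euclideanreal \<tau>) \<tau> (\<lambda>(a, x). a \<odot>\<^bsub>U\<^esub> x)"

text \<open>
  The ambient \<open>U\<close> is an explicit part of an interpolation pair: \<open>X\<close> and \<open>Y\<close> alone do not
  determine the sums of their elements.
\<close>

definition interpolation_pair :: "'a vlat \<Rightarrow> 'a blat \<Rightarrow> 'a blat \<Rightarrow> bool" where
  "interpolation_pair U X Y \<longleftrightarrow>
     vector_lattice U \<and> banach_lattice X \<and> banach_lattice Y \<and>
     order_ideal X U \<and> order_ideal Y U \<and>
     (\<exists>\<tau>. hausdorff_tvs U \<tau> \<and> continuous_map (norm_topology X) \<tau> id \<and>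
          continuous_map (norm_topology Y) \<tau> id)"

definition pair_inter :: "'a vlat \<Rightarrow> 'a blat \<Rightarrow> 'a blat \<Rightarrow> 'a blat" where
  "pair_inter U X Y =
     \<lparr>carrier = carrier X \<inter> carrier Y, mult = mult U, one = one U, zero = zero U, add = add U,
      smult = smult U, vle = vle U, vnorm = (\<lambda>x. max (\<parallel>x\<parallel>\<^bsub>X\<^esub>) (\<parallel>x\<parallel>\<^bsub>Y\<^esub>))\<rparr>"

definition pair_sum :: "'a vlat \<Rightarrow> 'a blat \<Rightarrow> 'a blat \<Rightarrow> 'a blat" where
  "pair_sum U X Y =
     \<lparr>carrier = {x \<oplus>\<^bsub>U\<^esub> y | x y. x \<in> carrier X \<and> y \<in> carrier Y},
      mult = mult U, one = one U, zero = zero U, add = add U, smult = smult U, vle = vle U,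
      vnorm = (\<lambda>z. Inf {\<parallel>x\<parallel>\<^bsub>X\<^esub> + \<parallel>y\<parallel>\<^bsub>Y\<^esub> | x y.
                         x \<in> carrier X \<and> y \<in> carrier Y \<and> z = x \<oplus>\<^bsub>U\<^esub> y})\<rparr>"

definition linear_op :: "('a, 'm) vlat_scheme \<Rightarrow> ('a \<Rightarrow> 'a) \<Rightarrow> bool" where
  "linear_op E T \<longleftrightarrow> T \<in> hom (add_monoid E) (add_monoid E) \<and>
     (\<forall>a. \<forall>x\<in>carrier E. T (a \<odot>\<^bsub>E\<^esub> x) = a \<odot>\<^bsub>E\<^esub> T x)"

definition pos_ops :: "('a, 'm) vlat_scheme \<Rightarrow> ('a \<Rightarrow> 'a) set" where
  "pos_ops E = {T. linear_op E T \<and> T ` pos_cone E \<subseteq> pos_cone E}"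

definition pair_pos_ops :: "'a vlat \<Rightarrow> 'a blat \<Rightarrow> 'a blat \<Rightarrow> ('a \<Rightarrow> 'a) set" where
  "pair_pos_ops U X Y = {T. linear_op (pair_sum U X Y) T \<and> T \<in> pos_ops X \<and> T \<in> pos_ops Y}"

text \<open>Valued in \<open>ennreal\<close>, so that no junk value arises before boundedness is known.\<close>

definition op_norm :: "('a, 'm) blat_scheme \<Rightarrow> ('a \<Rightarrow> 'a) \<Rightarrow> ennreal" where
  "op_norm E T = (SUP x\<in>{x \<in> carrier E. \<parallel>x\<parallel>\<^bsub>E\<^esub> \<le> 1}. ennreal (\<parallel>T x\<parallel>\<^bsub>E\<^esub>))"

definition intermediate :: "'a vlat \<Rightarrow> 'a blat \<Rightarrow> 'a blat \<Rightarrow> 'a blat \<Rightarrow> bool" where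
  "intermediate U X Y Z \<longleftrightarrow>
     banach_lattice Z \<and> pair_inter U X Y \<hookrightarrow> Z \<and> Z \<hookrightarrow> pair_sum U X Y"

definition P_Int_const :: "real \<Rightarrow> 'a vlat \<Rightarrow> 'a blat \<Rightarrow> 'a blat \<Rightarrow> 'a blat set" where
  "P_Int_const c U X Y = {Z. intermediate U X Y Z \<and>
     (\<forall>T\<in>pair_pos_ops U X Y. T ` carrier Z \<subseteq> carrier Z \<and>
        op_norm Z T \<le> ennreal c * max (op_norm X T) (op_norm Y T))}"

definition P_Int :: "'a vlat \<Rightarrow> 'a blat \<Rightarrow> 'a blat \<Rightarrow> 'a blat set" where
  "P_Int U X Y = (\<Union>c\<in>{1..}. P_Int_const c U X Y)"

end

theory Submission
  imports Defs "HOL-Real_Asymp.Real_Asymp"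
begin

text \<open>
  The spaces \<open>X\<close> and \<open>Y\<close> are interpolation spaces of their own pair, so each of the four spaces is
  an interpolation space of the other pair.  This gives \<open>X \<inter> Y = V \<inter> W\<close> and allows to split
  positive elements of \<open>X\<close> or \<open>Y\<close> between \<open>V\<close> and \<open>W\<close>, and conversely.  The heart of the proof is the
  dichotomy \<open>subset_dichotomy\<close>: if \<open>X \<subseteq> Y\<close> fails then \<open>X\<close> lies in \<open>V\<close> or in \<open>W\<close>.  Applied to all
  four spaces it leaves, up to exchanging the spaces in a pair and exchanging the pairs, only the
  case \<open>X \<subseteq> V\<close> and \<open>Y \<subseteq> W\<close>, where the modular law for ideals turns the inclusions into
  equalities (\<open>subset_by_modularity\<close>).  Equal carriers already imply equivalent norms, because
  inclusions of Banach ideals are bounded (\<open>inclusion_bounded\<close>).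

  The dichotomy only uses operators \<open>f \<otimes> z : s \<mapsto> f(s) z\<close> of rank one, with \<open>z \<ge> 0\<close> and a positive
  functional \<open>f\<close> on \<open>X + Y\<close>.  The functionals come from the Hahn-Banach theorem, applied to the
  \<open>K\<close>-functional \<open>gauge \<epsilon>\<close>, essentially \<open>s \<mapsto> inf {\<parallel>x\<parallel>\<^bsub>X\<^esub> + \<epsilon> \<parallel>y\<parallel>\<^bsub>Y\<^esub> | s \<le> x + y}\<close>: they
  are bounded by \<open>1\<close> on \<open>X\<close> and by \<open>\<epsilon>\<close> on \<open>Y\<close>.

  If \<open>Y\<close> is not dense in \<open>X + Y\<close>, there is a nonzero \<open>f\<close> that vanishes on \<open>Y\<close>.  It does not vanish
  on \<open>V\<close>, say, and then the operators \<open>f \<otimes> z\<close> with \<open>z\<close> in \<open>X\<close> map \<open>V\<close> onto every line of \<open>X\<close>, so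
  that \<open>X \<subseteq> V\<close>.  If \<open>Y\<close> is dense, then \<open>X \<inter> Y\<close> is dense in \<open>X\<close>.  When \<open>gauge \<epsilon>\<close> is for some
  \<open>\<epsilon> > 0\<close> much smaller than the norms of \<open>V\<close> and \<open>W\<close>, it is much smaller than the norm of \<open>X\<close>, and
  successive approximation in the manner of the open mapping theorem shows \<open>X \<subseteq> Y\<close>
  (\<open>subset_by_halving\<close>).  Otherwise, on \<open>V\<close> or on \<open>W\<close>, the functionals \<open>f\<close> stay away from zero while
  \<open>\<epsilon>\<close> tends to zero.  The interpolation inequality for \<open>f \<otimes> z\<close> with \<open>z\<close> in \<open>X \<inter> Y\<close> then bounds
  the norm of \<open>z\<close> in \<open>V\<close>, say, by a multiple of \<open>max \<parallel>z\<parallel>\<^bsub>X\<^esub> (\<epsilon> \<parallel>z\<parallel>\<^bsub>Y\<^esub>)\<close>, hence by a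
  multiple of \<open>\<parallel>z\<parallel>\<^bsub>X\<^esub>\<close>, and density yields \<open>X \<subseteq> V\<close>.
\<close>

section \<open>Order and truncation in a vector lattice\<close>

lemma real_ring_simps [simp]:
  "carrier real_ring = UNIV" "zero real_ring = 0" "one real_ring = 1"
  "a \<oplus>\<^bsub>real_ring\<^esub> b = a + b" "a \<otimes>\<^bsub>real_ring\<^esub> b = a * b"
  by (simp_all add: real_ring_def)

lemma vorder_simps [simp]:
  "carrier (vorder E) = carrier E" "le (vorder E) = vle E" "eq (vorder E) = (=)"
  by (simp_all add: vorder_def)

context vector_lattice
begin

lemma one_smult [simp]: "x \<in> carrier E \<Longrightarrow> 1 \<odot> x = x"
  using smult_one[of x] by simp

lemma vle_refl [simp]: "x \<in> carrier E \<Longrightarrow> x \<preceq> x"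
  using order.le_refl[of x] by simp

lemma vle_trans:
  "\<lbrakk>x \<preceq> y; y \<preceq> z; x \<in> carrier E; y \<in> carrier E; z \<in> carrier E\<rbrakk> \<Longrightarrow> x \<preceq> z"
  using order.le_trans[of x y z] by simp

lemma vle_antisym: "\<lbrakk>x \<preceq> y; y \<preceq> x; x \<in> carrier E; y \<in> carrier E\<rbrakk> \<Longrightarrow> x = y"
  using order.le_antisym[of x y] by simp

lemma ex_sup:
  assumes "x \<in> carrier E" "y \<in> carrier E"
  shows "\<exists>s\<in>carrier E. x \<preceq> s \<and> y \<preceq> s \<and> (\<forall>z\<in>carrier E. x \<preceq> z \<longrightarrow> y \<preceq> z \<longrightarrow> s \<preceq> z)"
  using order.join_left[of x y] order.join_right[of x y] order.join_le[of x _ y] assms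
  by (intro bexI[of _ "x \<squnion>\<^bsub>vorder E\<^esub> y"]) (use order.join_closed[of x y] in auto)

lemma vle_add:
  assumes "x \<preceq> y" "x' \<preceq> y'"
    and c: "x \<in> carrier E" "y \<in> carrier E" "x' \<in> carrier E" "y' \<in> carrier E"
  shows "x \<oplus> x' \<preceq> y \<oplus> y'"
proof -
  have "x \<oplus> x' \<preceq> y \<oplus> x'" using add_mono[of x y x'] assms by simp
  moreover have "y \<oplus> x' \<preceq> y \<oplus> y'"
    using add_mono[of x' y' y] assms by (simp add: M.a_comm)
  ultimately show ?thesis using c by (meson M.a_closed vle_trans)
qed

lemma vle_minus_iff:
  assumes "x \<in> carrier E" "y \<in> carrier E" "z \<in> carrier E"
  shows "x \<ominus> y \<preceq> z \<longleftrightarrow> x \<preceq> y \<oplus> z"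
proof
  assume "x \<ominus> y \<preceq> z"
  then have "(x \<ominus> y) \<oplus> y \<preceq> z \<oplus> y" using assms by (intro add_mono) auto
  moreover have "(x \<ominus> y) \<oplus> y = x" using assms by (simp add: M.minus_eq M.a_assoc M.l_neg)
  ultimately show "x \<preceq> y \<oplus> z" using assms by (simp add: M.a_comm)
next
  assume "x \<preceq> y \<oplus> z"
  then have "x \<oplus> (\<ominus> y) \<preceq> (y \<oplus> z) \<oplus> (\<ominus> y)" using assms by (intro add_mono) auto
  then show "x \<ominus> y \<preceq> z" using assms
    by (simp add: M.minus_eq M.a_assoc M.r_neg1 M.r_neg2 M.a_comm[of z])
qed

lemma minus_nonneg_iff:
  assumes "x \<in> carrier E" "y \<in> carrier E"
  shows "\<zero> \<preceq> y \<ominus> x \<longleftrightarrow> x \<preceq> y"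
proof
  assume "\<zero> \<preceq> y \<ominus> x"
  then have "\<zero> \<oplus> x \<preceq> (y \<ominus> x) \<oplus> x" using assms by (intro add_mono) auto
  then show "x \<preceq> y" using assms by (simp add: M.minus_eq M.a_assoc M.l_neg)
next
  assume "x \<preceq> y"
  then have "x \<oplus> (\<ominus> x) \<preceq> y \<oplus> (\<ominus> x)" using assms by (intro add_mono) auto
  then show "\<zero> \<preceq> y \<ominus> x" using assms by (simp add: M.minus_eq M.r_neg)
qed

lemma add_nonneg:
  "\<lbrakk>\<zero> \<preceq> x; \<zero> \<preceq> y; x \<in> carrier E; y \<in> carrier E\<rbrakk> \<Longrightarrow> \<zero> \<preceq> x \<oplus> y"
  using vle_add[of \<zero> x \<zero> y] by simp

lemma vle_add_right:
  "\<lbrakk>\<zero> \<preceq> y; x \<in> carrier E; y \<in> carrier E\<rbrakk> \<Longrightarrow> x \<preceq> x \<oplus> y"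
  using vle_add[of x x \<zero> y] by simp

lemma smult_nonneg: "\<lbrakk>\<zero> \<preceq> x; x \<in> carrier E; 0 \<le> a\<rbrakk> \<Longrightarrow> \<zero> \<preceq> a \<odot> x"
  using smult_mono[of \<zero> x a] by simp

lemma neg_smult: "x \<in> carrier E \<Longrightarrow> (- 1) \<odot> x = \<ominus> x"
proof -
  have "\<ominus>\<^bsub>real_ring\<^esub> (1::real) = - 1"
    using R.minus_equality[of "- 1" 1] by simp
  then show "x \<in> carrier E \<Longrightarrow> (- 1) \<odot> x = \<ominus> x"
    using smult_l_minus[of 1 x] by simp
qed

lemma nonneg_of_symmetric:
  assumes "x \<preceq> a" "\<ominus> x \<preceq> a" and c: "x \<in> carrier E" "a \<in> carrier E"
  shows "\<zero> \<preceq> a"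
proof -
  have "x \<oplus> \<ominus> x \<preceq> a \<oplus> a" using assms by (intro vle_add) auto
  then have "\<zero> \<preceq> (1 + 1) \<odot> a" using c smult_l_distr[of 1 1 a] by (simp add: M.r_neg)
  then have "\<zero> \<preceq> (1/2) \<odot> ((1 + 1) \<odot> a)" using c smult_nonneg[of "(1 + 1) \<odot> a" "1/2"] by simp
  then show ?thesis using c smult_assoc1[of "1/2" 2 a] by simp
qed

text \<open>
  The witness is the positive part of \<open>u - x\<close>, the smallest correction that makes \<open>x\<close> dominate
  \<open>u\<close>.  Stating its properties with sums only spares the later arguments all subtractions.
\<close>

lemma truncation:
  assumes "u \<in> carrier E" "x \<in> carrier E" "\<zero> \<preceq> u" "\<zero> \<preceq> x"
  obtains z where "z \<in> carrier E" "\<zero> \<preceq> z" "z \<preceq> u" "u \<preceq> x \<oplus> z"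
    "\<And>y. \<lbrakk>y \<in> carrier E; \<zero> \<preceq> y; u \<preceq> x \<oplus> y\<rbrakk> \<Longrightarrow> z \<preceq> y"
proof -
  obtain z where z: "z \<in> carrier E" "u \<ominus> x \<preceq> z" "\<zero> \<preceq> z"
    and least: "\<And>y. \<lbrakk>y \<in> carrier E; u \<ominus> x \<preceq> y; \<zero> \<preceq> y\<rbrakk> \<Longrightarrow> z \<preceq> y"
    using ex_sup[of "u \<ominus> x" \<zero>] assms by auto
  have "u \<preceq> x \<oplus> u" using assms vle_add_right[of x u] by (simp add: M.a_comm)
  then show thesis
    using z least assms by (intro that[of z]) (auto simp: vle_minus_iff)
qed

lemma riesz_decomposition:
  assumes c: "u \<in> carrier E" "x \<in> carrier E" "y \<in> carrier E"
    and "\<zero> \<preceq> u" "\<zero> \<preceq> x" "\<zero> \<preceq> y" "u \<preceq> x \<oplus> y"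
  obtains x' y' where "x' \<in> carrier E" "y' \<in> carrier E" "\<zero> \<preceq> x'" "\<zero> \<preceq> y'"
    "x' \<preceq> x" "y' \<preceq> y" "x' \<preceq> u" "y' \<preceq> u" "u \<preceq> x' \<oplus> y'"
proof -
  obtain y' where y': "y' \<in> carrier E" "\<zero> \<preceq> y'" "y' \<preceq> u" "u \<preceq> x \<oplus> y'" "y' \<preceq> y"
    using truncation[of u x] assms by metis
  then have "u \<preceq> y' \<oplus> x" using c by (simp add: M.a_comm)
  then obtain x' where x': "x' \<in> carrier E" "\<zero> \<preceq> x'" "x' \<preceq> u" "u \<preceq> y' \<oplus> x'" "x' \<preceq> x"
    using truncation[of u y'] assms y' by metis
  then show thesis using that[of x' y'] y' by (simp add: M.a_comm)
qed

lemma neg_le_self: "\<lbrakk>\<zero> \<preceq> y; y \<in> carrier E\<rbrakk> \<Longrightarrow> \<ominus> y \<preceq> y"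
  using add_nonneg[of y y] vle_minus_iff[of \<zero> y y] by (simp add: M.minus_eq)

lemma vabs_bounds:
  assumes "x \<in> carrier E"
  shows "vabs E x \<in> carrier E" "x \<preceq> vabs E x" "\<ominus> x \<preceq> vabs E x"
    "\<And>a. \<lbrakk>a \<in> carrier E; x \<preceq> a; \<ominus> x \<preceq> a\<rbrakk> \<Longrightarrow> vabs E x \<preceq> a"
    "\<zero> \<preceq> vabs E x"
proof -
  show 1: "vabs E x \<in> carrier E" using order.join_closed[of x "\<ominus> x"] assms by (simp add: vabs_def)
  show 2: "x \<preceq> vabs E x" using order.join_left[of x "\<ominus> x"] assms by (simp add: vabs_def)
  show 3: "\<ominus> x \<preceq> vabs E x" using order.join_right[of x "\<ominus> x"] assms by (simp add: vabs_def)
  show "\<And>a. \<lbrakk>a \<in> carrier E; x \<preceq> a; \<ominus> x \<preceq> a\<rbrakk> \<Longrightarrow> vabs E x \<preceq> a"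
    using order.join_le[of x _ "\<ominus> x"] assms by (simp add: vabs_def)
  show "\<zero> \<preceq> vabs E x" using nonneg_of_symmetric[OF 2 3 assms 1] .
qed

lemma vabs_nonneg_eq: "\<lbrakk>\<zero> \<preceq> y; y \<in> carrier E\<rbrakk> \<Longrightarrow> vabs E y = y"
  using vabs_bounds[of y] neg_le_self[of y] by (intro vle_antisym) auto

end

section \<open>Positive series and Banach ideals\<close>

primrec psum :: "('a, 'm) ring_scheme \<Rightarrow> (nat \<Rightarrow> 'a) \<Rightarrow> nat \<Rightarrow> 'a" where
  "psum G a 0 = \<zero>\<^bsub>G\<^esub>"
| "psum G a (Suc n) = psum G a n \<oplus>\<^bsub>G\<^esub> a n"

lemma (in vector_lattice) add_diff_swap:
  assumes "x \<in> carrier E" "y \<in> carrier E" "z \<in> carrier E"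
  shows "(x \<oplus> y) \<ominus> z = (x \<ominus> z) \<oplus> y"
proof -
  have "y \<oplus> \<ominus> z = \<ominus> z \<oplus> y" using assms by (intro M.a_comm) auto
  then show ?thesis using assms by (simp add: M.minus_eq M.a_assoc)
qed

context banach_lattice
begin

lemma norm_le_majorant:
  assumes "x \<in> carrier E" "a \<in> carrier E" "x \<preceq> a" "\<ominus> x \<preceq> a"
  shows "\<parallel>x\<parallel> \<le> \<parallel>a\<parallel>"
  using assms nonneg_of_symmetric[of x a] by (intro norm_mono) (auto simp: vabs_nonneg_eq vabs_bounds)

lemma norm_le_of_le_vabs:
  assumes "q \<in> carrier E" "x \<in> carrier E" "\<zero> \<preceq> q" "q \<preceq> vabs E x"
  shows "\<parallel>q\<parallel> \<le> \<parallel>x\<parallel>"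
  using assms by (intro norm_mono) (auto simp: vabs_nonneg_eq vabs_bounds)

lemma norm_vabs: "x \<in> carrier E \<Longrightarrow> \<parallel>vabs E x\<parallel> = \<parallel>x\<parallel>"
  using norm_le_majorant[of x "vabs E x"] norm_le_of_le_vabs[of "vabs E x" x]
  by (simp add: vabs_bounds)

text \<open>
  Partial sums that increase lie below their norm limit, since the positive cone is closed.
\<close>

lemma positive_series_bounded:
  assumes a: "\<And>n. a n \<in> carrier E" "\<And>n. \<zero> \<preceq> a n" and norm_a: "\<And>n. \<parallel>a n\<parallel> \<le> C / 2 ^ n"
  obtains b where "b \<in> carrier E" "\<And>n. psum E a n \<preceq> b"
proof -
  interpret MS: Metric_space "carrier E" "vdist E" by (rule Metric_space_vdist)
  define s where "s = psum E a"
  have sc: "s n \<in> carrier E" for n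
    unfolding s_def by (induction n) (use a in auto)
  have s_Suc: "s (Suc n) = s n \<oplus> a n" for n by (simp add: s_def)
  have mono: "s n \<preceq> s (n + k)" for n k
  proof (induction k)
    case (Suc k)
    have "s (n + k) \<preceq> s (n + Suc k)"
      using vle_add_right[of "a (n + k)" "s (n + k)"] sc a by (simp add: s_Suc)
    then show ?case using Suc sc vle_trans by blast
  qed (simp add: sc)
  have diff: "\<parallel>s (n + k) \<ominus> s n\<parallel> \<le> C * (2 / 2 ^ n - 2 / 2 ^ (n + k))" for n k
  proof (induction k)
    case 0
    have "s n \<ominus> s n = \<zero>" using sc by (simp add: M.minus_eq M.r_neg)
    then show ?case using norm_eq_zero[of \<zero>] by simp
  next
    case (Suc k)
    have "s (n + Suc k) \<ominus> s n = (s (n + k) \<ominus> s n) \<oplus> a (n + k)"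
      using add_diff_swap[of "s (n + k)" "a (n + k)" "s n"] sc a by (simp add: s_Suc)
    then have "\<parallel>s (n + Suc k) \<ominus> s n\<parallel> \<le> \<parallel>s (n + k) \<ominus> s n\<parallel> + \<parallel>a (n + k)\<parallel>"
      using norm_triangle[of "s (n + k) \<ominus> s n" "a (n + k)"] sc a by simp
    also have "\<dots> \<le> C * (2 / 2 ^ n - 2 / 2 ^ (n + k)) + C / 2 ^ (n + k)"
      using Suc norm_a[of "n + k"] by linarith
    also have "\<dots> = C * (2 / 2 ^ n - 2 / 2 ^ (n + Suc k))"
    proof -
      have "(2::real) / 2 ^ (n + Suc k) = 1 / 2 ^ (n + k)" by simp
      then show ?thesis by (simp add: right_diff_distrib)
    qed
    finally show ?case .
  qed
  have "0 \<le> C" using order_trans[OF norm_nonneg[OF a(1)] norm_a, of 0] by simp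
  have diff': "vdist E (s m) (s n) \<le> 2 * C / 2 ^ n" if "n \<le> m" for n m
  proof -
    from that obtain k where m: "m = n + k" using le_Suc_ex by blast
    have "C * (2 / 2 ^ n - 2 / 2 ^ (n + k)) \<le> C * (2 / 2 ^ n)"
      using \<open>0 \<le> C\<close> by (intro mult_left_mono) auto
    then have "\<parallel>s (n + k) \<ominus> s n\<parallel> \<le> 2 * C / 2 ^ n" using diff[of n k] by (simp add: mult.commute)
    then show ?thesis using sc by (simp add: vdist_def m)
  qed
  have "MS.MCauchy s"
    unfolding MS.MCauchy_def
  proof (intro conjI allI impI)
    show "range s \<subseteq> carrier E" using sc by auto
    fix e :: real assume "0 < e"
    have "(\<lambda>n. 2 * C / 2 ^ n) \<longlonglongrightarrow> 0" by real_asymp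
    then have "eventually (\<lambda>n. 2 * C / 2 ^ n < e) sequentially"
      using \<open>0 < e\<close> by (rule order_tendstoD)
    then obtain N where N: "2 * C / 2 ^ n < e" if "N \<le> n" for n
      by (auto simp: eventually_sequentially)
    have "vdist E (s n) (s n') < e" if "N \<le> n" "N \<le> n'" for n n'
    proof (cases "n \<le> n'")
      case True
      then show ?thesis using diff'[OF True] N[OF that(1)] MS.commute[of "s n" "s n'"] by simp
    next
      case False
      then show ?thesis using diff'[of n' n] N[OF that(2)] by simp
    qed
    then show "\<exists>N. \<forall>n n'. N \<le> n \<longrightarrow> N \<le> n' \<longrightarrow> vdist E (s n) (s n') < e" by blast
  qed
  then obtain l where l: "l \<in> carrier E"
    and lim: "\<And>e. 0 < e \<Longrightarrow> \<exists>N. \<forall>n\<ge>N. vdist E (s n) l < e"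
    using complete unfolding MS.mcomplete_def MS.limit_metric_sequentially by meson
  have "s n \<preceq> l" for n
  proof -
    \<comment> \<open>the positive part of \<open>s n - l\<close> lies below \<open>\<bar>s m - l\<bar>\<close> for all later \<open>m\<close>\<close>
    obtain q where q: "q \<in> carrier E" "s n \<ominus> l \<preceq> q" "\<zero> \<preceq> q"
      and least: "\<And>z. \<lbrakk>z \<in> carrier E; s n \<ominus> l \<preceq> z; \<zero> \<preceq> z\<rbrakk> \<Longrightarrow> q \<preceq> z"
      using ex_sup[of "s n \<ominus> l" \<zero>] sc l by auto
    have small: "\<parallel>q\<parallel> \<le> \<parallel>s m \<ominus> l\<parallel>" if "n \<le> m" for m
    proof -
      have "s n \<preceq> s m" using mono[of n "m - n"] that by simp
      then have "s n \<ominus> l \<preceq> s m \<ominus> l" using sc l by (simp add: M.minus_eq add_mono)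
      then have "s n \<ominus> l \<preceq> vabs E (s m \<ominus> l)"
        using vabs_bounds[of "s m \<ominus> l"] sc l by (meson M.minus_closed vle_trans)
      then have "q \<preceq> vabs E (s m \<ominus> l)" using least vabs_bounds[of "s m \<ominus> l"] sc l by simp
      then show ?thesis using norm_le_of_le_vabs q sc l by simp
    qed
    have "\<parallel>q\<parallel> \<le> e" if "0 < e" for e
    proof -
      from lim[OF that] obtain N where "\<forall>m\<ge>N. vdist E (s m) l < e" by auto
      then have "vdist E (s (max N n)) l < e" by simp
      then show ?thesis using small[of "max N n"] sc l by (simp add: vdist_def)
    qed
    then have "\<parallel>q\<parallel> = 0" using norm_nonneg[OF q(1)] field_le_epsilon[of "\<parallel>q\<parallel>" 0] by fastforce
    then have "q = \<zero>" using norm_eq_zero q(1) by simp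
    then show ?thesis using q sc l by (simp add: vle_minus_iff)
  qed
  then show thesis using that[of l] l by (simp add: s_def)
qed

end

text \<open>
  Solidity is asked for positive elements only; together with the lattice structure of \<open>I\<close>
  this is the usual notion of an ideal (\<open>banach_ideal_iff\<close> below).
\<close>

locale banach_ideal = vector_lattice U for U :: "('a, 'm) vlat_scheme" (structure) +
  fixes I :: "('a, 'n) blat_scheme"
  assumes banach: "banach_lattice I"
    and ops: "same_ops I U"
    and subset: "carrier I \<subseteq> carrier U"
    and solid: "\<lbrakk>x \<in> carrier I; y \<in> carrier U; \<zero> \<preceq> y; y \<preceq> x\<rbrakk> \<Longrightarrow> y \<in> carrier I"
begin

sublocale I: banach_lattice I by (rule banach)

lemma in_carrier: "x \<in> carrier I \<Longrightarrow> x \<in> carrier U"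
  using subset by blast

lemma zero_in [simp]: "\<zero> \<in> carrier I"
  using I.M.zero_closed ops by (simp add: same_ops_def del: I.M.zero_closed)

lemma op_eqs:
  "\<zero>\<^bsub>I\<^esub> = \<zero>"
  "\<lbrakk>x \<in> carrier I; y \<in> carrier I\<rbrakk> \<Longrightarrow> x \<oplus>\<^bsub>I\<^esub> y = x \<oplus> y"
  "x \<in> carrier I \<Longrightarrow> a \<odot>\<^bsub>I\<^esub> x = a \<odot> x"
  "\<lbrakk>x \<in> carrier I; y \<in> carrier I\<rbrakk> \<Longrightarrow> x \<preceq>\<^bsub>I\<^esub> y \<longleftrightarrow> x \<preceq> y"
  using ops by (auto simp: same_ops_def)

lemma add_in: "\<lbrakk>x \<in> carrier I; y \<in> carrier I\<rbrakk> \<Longrightarrow> x \<oplus> y \<in> carrier I"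
  using I.M.a_closed[of x y] by (simp add: op_eqs)

lemma smult_in: "x \<in> carrier I \<Longrightarrow> a \<odot> x \<in> carrier I"
  using I.smult_closed[of a x] by (simp add: op_eqs)

lemma neg_eq: "x \<in> carrier I \<Longrightarrow> \<ominus>\<^bsub>I\<^esub> x = \<ominus> x"
  using I.neg_smult[of x] neg_smult[of x] op_eqs(3)[of x "- 1"] in_carrier[of x] by simp

lemma neg_in: "x \<in> carrier I \<Longrightarrow> \<ominus> x \<in> carrier I"
  using I.M.a_inv_closed[of x] by (simp add: neg_eq)

lemma minus_in: "\<lbrakk>x \<in> carrier I; y \<in> carrier I\<rbrakk> \<Longrightarrow> x \<ominus> y \<in> carrier I"
  by (simp add: M.minus_eq add_in neg_in)

lemma norm_add: "\<lbrakk>x \<in> carrier I; y \<in> carrier I\<rbrakk> \<Longrightarrow> \<parallel>x \<oplus> y\<parallel>\<^bsub>I\<^esub> \<le> \<parallel>x\<parallel>\<^bsub>I\<^esub> + \<parallel>y\<parallel>\<^bsub>I\<^esub>"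
  using I.norm_triangle[of x y] by (simp add: op_eqs)

lemma norm_scale: "x \<in> carrier I \<Longrightarrow> \<parallel>a \<odot> x\<parallel>\<^bsub>I\<^esub> = \<bar>a\<bar> * \<parallel>x\<parallel>\<^bsub>I\<^esub>"
  using I.norm_smult[of x a] by (simp add: op_eqs)

lemma norm_zero [simp]: "\<parallel>\<zero>\<parallel>\<^bsub>I\<^esub> = 0"
  using I.norm_eq_zero[of \<zero>] by (simp add: op_eqs)

lemma norm_0_iff: "x \<in> carrier I \<Longrightarrow> \<parallel>x\<parallel>\<^bsub>I\<^esub> = 0 \<longleftrightarrow> x = \<zero>"
  using I.norm_eq_zero[of x] by (simp add: op_eqs)

lemma norm_majorant:
  "\<lbrakk>x \<in> carrier I; a \<in> carrier I; x \<preceq> a; \<ominus> x \<preceq> a\<rbrakk> \<Longrightarrow> \<parallel>x\<parallel>\<^bsub>I\<^esub> \<le> \<parallel>a\<parallel>\<^bsub>I\<^esub>"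
  using I.norm_le_majorant[of x a] by (simp add: op_eqs neg_eq neg_in)

lemma norm_positive_mono:
  assumes "x \<in> carrier I" "y \<in> carrier I" "\<zero> \<preceq> x" "x \<preceq> y"
  shows "\<parallel>x\<parallel>\<^bsub>I\<^esub> \<le> \<parallel>y\<parallel>\<^bsub>I\<^esub>"
proof (rule norm_majorant[OF assms(1,2,4)])
  show "\<ominus> x \<preceq> y"
    using neg_le_self[of x] assms in_carrier by (meson M.a_inv_closed vle_trans)
qed

lemma majorant:
  assumes "x \<in> carrier I"
  obtains a where "a \<in> carrier I" "\<zero> \<preceq> a" "x \<preceq> a" "\<ominus> x \<preceq> a" "\<parallel>a\<parallel>\<^bsub>I\<^esub> = \<parallel>x\<parallel>\<^bsub>I\<^esub>"
  using that[of "vabs I x"] I.vabs_bounds[of x] I.norm_vabs[of x] assms neg_in[of x]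
  by (simp add: op_eqs neg_eq)

lemma series_bounded:
  assumes a: "\<And>n. a n \<in> carrier I" "\<And>n. \<zero> \<preceq> a n" and "\<And>n. \<parallel>a n\<parallel>\<^bsub>I\<^esub> \<le> C / 2 ^ n"
  obtains b where "b \<in> carrier I" "\<And>n. psum U a n \<preceq> b"
proof -
  have eq: "psum I a n = psum U a n \<and> psum U a n \<in> carrier I" for n
    by (induction n) (auto simp: op_eqs a add_in)
  obtain b where "b \<in> carrier I" "\<And>n. psum I a n \<preceq>\<^bsub>I\<^esub> b"
    using I.positive_series_bounded[of a C] assms by (auto simp: op_eqs)
  then show thesis using that[of b] eq op_eqs(4) by metis
qed

lemma null_of_geometric:
  assumes "z \<in> carrier I" "\<And>n. \<parallel>z\<parallel>\<^bsub>I\<^esub> \<le> K / 2 ^ n"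
  shows "z = \<zero>"
proof -
  have "(\<lambda>n. K / 2 ^ n) \<longlonglongrightarrow> 0" by real_asymp
  then have "\<parallel>z\<parallel>\<^bsub>I\<^esub> \<le> 0" by (rule Lim_bounded2) (use assms in auto)
  then show ?thesis using norm_0_iff I.norm_nonneg assms(1) by fastforce
qed

lemma subset_if_positive_subset:
  assumes "banach_ideal U F"
    and pos: "\<And>x. \<lbrakk>x \<in> carrier I; \<zero> \<preceq> x\<rbrakk> \<Longrightarrow> x \<in> carrier F"
  shows "carrier I \<subseteq> carrier F"
proof
  interpret F: banach_ideal U F by fact
  fix x assume x: "x \<in> carrier I"
  then obtain a where a: "a \<in> carrier I" "\<zero> \<preceq> a" "x \<preceq> a" using majorant by metis
  have "a \<ominus> x \<in> carrier F" using x a by (intro pos) (auto simp: minus_in minus_nonneg_iff in_carrier)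
  moreover have "a \<in> carrier F" using a pos by simp
  moreover have "a \<ominus> (a \<ominus> x) = x" using x a
    by (simp add: in_carrier M.minus_eq M.minus_add M.r_neg1 M.r_neg2)
  ultimately show "x \<in> carrier F" using F.minus_in by metis
qed

end

text \<open>
  Halving the remainder again and again exhausts a positive element of \<open>X\<close> by a positive series
  with summable norms in \<open>F\<close>, hence with an upper bound there.  The order makes the two norms
  compatible: by truncation, the part of the element that exceeds this bound lies below every
  remainder, so that its norm in \<open>X\<close> vanishes.
\<close>

lemma subset_by_halving:
  fixes U (structure)
  assumes "banach_ideal U X" "banach_ideal U F" "0 \<le> C"
    and step: "\<And>x. \<lbrakk>x \<in> carrier X; \<zero> \<preceq> x\<rbrakk> \<Longrightarrow> \<exists>x'\<in>carrier X. \<exists>b\<in>carrier F.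
       \<zero> \<preceq> x' \<and> \<zero> \<preceq> b \<and> x \<preceq> x' \<oplus> b \<and> \<parallel>x'\<parallel>\<^bsub>X\<^esub> \<le> \<parallel>x\<parallel>\<^bsub>X\<^esub> / 2 \<and> \<parallel>b\<parallel>\<^bsub>F\<^esub> \<le> C * \<parallel>x\<parallel>\<^bsub>X\<^esub>"
  shows "carrier X \<subseteq> carrier F"
proof -
  interpret X: banach_ideal U X by fact
  interpret F: banach_ideal U F by fact
  obtain g h where gh: "\<And>x. \<lbrakk>x \<in> carrier X; \<zero> \<preceq> x\<rbrakk> \<Longrightarrow> g x \<in> carrier X \<and> h x \<in> carrier F \<and>
       \<zero> \<preceq> g x \<and> \<zero> \<preceq> h x \<and> x \<preceq> g x \<oplus> h x \<and> \<parallel>g x\<parallel>\<^bsub>X\<^esub> \<le> \<parallel>x\<parallel>\<^bsub>X\<^esub> / 2 \<and> \<parallel>h x\<parallel>\<^bsub>F\<^esub> \<le> C * \<parallel>x\<parallel>\<^bsub>X\<^esub>"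
    using step by metis
  show ?thesis
  proof (rule X.subset_if_positive_subset[OF F.banach_ideal_axioms])
    fix u assume u: "u \<in> carrier X" "\<zero> \<preceq> u"
    define r where "r n = (g ^^ n) u" for n
    define b where "b n = h (r n)" for n
    have r: "r n \<in> carrier X \<and> \<zero> \<preceq> r n \<and> \<parallel>r n\<parallel>\<^bsub>X\<^esub> \<le> \<parallel>u\<parallel>\<^bsub>X\<^esub> / 2 ^ n" for n
    proof (induction n)
      case (Suc n)
      then have "\<parallel>g (r n)\<parallel>\<^bsub>X\<^esub> \<le> (\<parallel>u\<parallel>\<^bsub>X\<^esub> / 2 ^ n) / 2"
        using gh[of "r n"] by (meson divide_right_mono order_trans zero_le_numeral)
      then show ?case using gh[of "r n"] Suc by (simp add: r_def mult.commute)
    qed (simp add: r_def u)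
    have b: "b n \<in> carrier F" "\<zero> \<preceq> b n" "\<parallel>b n\<parallel>\<^bsub>F\<^esub> \<le> (C * \<parallel>u\<parallel>\<^bsub>X\<^esub>) / 2 ^ n"
      and rS: "r n \<preceq> r (Suc n) \<oplus> b n" for n
      using gh[of "r n"] r[of n] mult_left_mono[of "\<parallel>r n\<parallel>\<^bsub>X\<^esub>" "\<parallel>u\<parallel>\<^bsub>X\<^esub> / 2 ^ n" C] \<open>0 \<le> C\<close>
      by (auto simp: b_def r_def)
    note carriers = r[THEN conjunct1, THEN X.in_carrier] b(1)[THEN F.in_carrier]
    have p: "psum U b n \<in> carrier U" for n by (induction n) (use carriers in auto)
    have cover: "u \<preceq> psum U b n \<oplus> r n" for n
    proof (induction n)
      case 0
      then show ?case using u X.in_carrier by (simp add: r_def)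
    next
      case (Suc n)
      have "psum U b n \<oplus> r n \<preceq> psum U b n \<oplus> (r (Suc n) \<oplus> b n)"
        using rS p carriers by (intro X.vle_add) auto
      also have "psum U b n \<oplus> (r (Suc n) \<oplus> b n) = psum U b (Suc n) \<oplus> r (Suc n)"
        using p carriers by (simp add: X.M.a_assoc X.M.a_comm[of "r (Suc n)" "b n"])
      finally show ?case
        using Suc u X.in_carrier p carriers by (meson X.M.a_closed X.vle_trans)
    qed
    obtain w where w: "w \<in> carrier F" "\<And>n. psum U b n \<preceq> w"
      using F.series_bounded[of b, OF b] by blast
    have w0: "\<zero> \<preceq> w" using w(2)[of 0] by simp
    note wc = F.in_carrier[OF w(1)] and uc = X.in_carrier[OF u(1)]
    obtain z where z: "z \<in> carrier U" "\<zero> \<preceq> z" "u \<preceq> w \<oplus> z"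
      and least: "\<And>y. \<lbrakk>y \<in> carrier U; \<zero> \<preceq> y; u \<preceq> w \<oplus> y\<rbrakk> \<Longrightarrow> z \<preceq> y"
      using X.truncation[OF uc wc u(2) w0] by metis
    have "psum U b n \<oplus> r n \<preceq> w \<oplus> r n" for n
      using w p carriers wc by (intro X.vle_add) auto
    then have zr: "z \<preceq> r n" for n
      using cover[of n] r[of n] uc wc p[of n] carriers
      by (intro least) (auto intro: X.vle_trans[of u "psum U b n \<oplus> r n"])
    have zX: "z \<in> carrier X" using X.solid[of "r 0" z] r z zr by blast
    have "\<parallel>z\<parallel>\<^bsub>X\<^esub> \<le> \<parallel>u\<parallel>\<^bsub>X\<^esub> / 2 ^ n" for n
      using X.norm_positive_mono[of z "r n"] zX r[of n] z zr[of n] by fastforce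
    then have "z = \<zero>" using X.null_of_geometric zX by blast
    then show "u \<in> carrier F" using F.solid[of w u] w uc u z wc by simp
  qed
qed

text \<open>
  An inclusion without a norm bound would produce a series of positive elements that is
  dominated in the smaller ideal although the norms of its terms in the larger one tend to
  infinity.
\<close>

lemma inclusion_bounded:
  fixes U (structure)
  assumes "banach_ideal U X" "banach_ideal U F" and sub: "carrier X \<subseteq> carrier F"
  obtains K where "0 < K" "\<And>x. x \<in> carrier X \<Longrightarrow> \<parallel>x\<parallel>\<^bsub>F\<^esub> \<le> K * \<parallel>x\<parallel>\<^bsub>X\<^esub>"
proof -
  interpret X: banach_ideal U X by fact
  interpret F: banach_ideal U F by fact
  have "\<exists>K>0. \<forall>x\<in>carrier X. \<zero> \<preceq> x \<longrightarrow> \<parallel>x\<parallel>\<^bsub>F\<^esub> \<le> K * \<parallel>x\<parallel>\<^bsub>X\<^esub>"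
  proof (rule ccontr)
    assume "\<not> ?thesis"
    \<comment> \<open>one factor \<open>2 ^ n\<close> makes the series converge, the other one lets its terms grow in \<open>F\<close>\<close>
    then have "\<forall>n::nat. \<exists>x\<in>carrier X. \<zero> \<preceq> x \<and> 4 ^ n * \<parallel>x\<parallel>\<^bsub>X\<^esub> < \<parallel>x\<parallel>\<^bsub>F\<^esub>"
      by (meson not_le zero_less_numeral zero_less_power)
    then obtain x where x: "\<And>n::nat. x n \<in> carrier X" "\<And>n. \<zero> \<preceq> x n"
      "\<And>n. 4 ^ n * \<parallel>x n\<parallel>\<^bsub>X\<^esub> < \<parallel>x n\<parallel>\<^bsub>F\<^esub>" by metis
    have pos: "0 < \<parallel>x n\<parallel>\<^bsub>X\<^esub>" for n
    proof -
      have "x n \<noteq> \<zero>" using x(3)[of n] by auto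
      then show ?thesis using X.norm_0_iff[of "x n"] X.I.norm_nonneg[of "x n"] x(1)[of n] by linarith
    qed
    define a where "a n = (1 / (2 ^ n * \<parallel>x n\<parallel>\<^bsub>X\<^esub>)) \<odot> x n" for n
    have a: "a n \<in> carrier X" "\<zero> \<preceq> a n" for n
      using x X.smult_in X.smult_nonneg X.in_carrier pos[of n] by (auto simp: a_def)
    have "\<parallel>a n\<parallel>\<^bsub>X\<^esub> \<le> 1 / 2 ^ n" for n
      using X.norm_scale[OF x(1)[of n]] pos[of n] by (simp add: a_def)
    then obtain b where b: "b \<in> carrier X" "\<And>n. psum U a n \<preceq> b"
      using X.series_bounded[of a 1, OF a] by blast
    have big: "2 ^ n < \<parallel>b\<parallel>\<^bsub>F\<^esub>" for n
    proof -
      have p: "psum U a n \<in> carrier U \<and> \<zero> \<preceq> psum U a n" for n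
        by (induction n) (use a X.in_carrier X.add_nonneg in auto)
      have "a n \<preceq> psum U a (Suc n)"
        using X.vle_add_right[of "psum U a n" "a n"] p[of n] a[of n] X.in_carrier
        by (simp add: X.M.a_comm)
      then have "a n \<preceq> b"
        using b X.in_carrier a p by (meson X.vle_trans)
      then have "\<parallel>a n\<parallel>\<^bsub>F\<^esub> \<le> \<parallel>b\<parallel>\<^bsub>F\<^esub>"
        using a b sub by (intro F.norm_positive_mono) auto
      moreover have "\<parallel>a n\<parallel>\<^bsub>F\<^esub> = \<parallel>x n\<parallel>\<^bsub>F\<^esub> / (2 ^ n * \<parallel>x n\<parallel>\<^bsub>X\<^esub>)"
        using F.norm_scale[of "x n"] x(1)[of n] sub pos[of n] by (auto simp: a_def)
      moreover have "2 ^ n < \<parallel>x n\<parallel>\<^bsub>F\<^esub> / (2 ^ n * \<parallel>x n\<parallel>\<^bsub>X\<^esub>)"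
      proof -
        have "(4::real) ^ n = 2 ^ n * 2 ^ n" by (simp flip: power_mult_distrib)
        then show ?thesis using x(3)[of n] pos[of n] by (simp add: pos_less_divide_eq mult.assoc)
      qed
      ultimately show ?thesis by linarith
    qed
    obtain n :: nat where "\<parallel>b\<parallel>\<^bsub>F\<^esub> < 2 ^ n" using real_arch_pow[of 2] by auto
    then show False using big[of n] by simp
  qed
  then obtain K where K: "0 < K" "\<And>x. \<lbrakk>x \<in> carrier X; \<zero> \<preceq> x\<rbrakk> \<Longrightarrow> \<parallel>x\<parallel>\<^bsub>F\<^esub> \<le> K * \<parallel>x\<parallel>\<^bsub>X\<^esub>" by blast
  have "\<parallel>x\<parallel>\<^bsub>F\<^esub> \<le> K * \<parallel>x\<parallel>\<^bsub>X\<^esub>" if x: "x \<in> carrier X" for x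
  proof -
    obtain a where a: "a \<in> carrier X" "\<zero> \<preceq> a" "x \<preceq> a" "\<ominus> x \<preceq> a" "\<parallel>a\<parallel>\<^bsub>X\<^esub> = \<parallel>x\<parallel>\<^bsub>X\<^esub>"
      by (rule X.majorant[OF x])
    have "\<parallel>x\<parallel>\<^bsub>F\<^esub> \<le> \<parallel>a\<parallel>\<^bsub>F\<^esub>" using a x sub by (intro F.norm_majorant) auto
    then show ?thesis using K(2)[of a] a by simp
  qed
  then show thesis using that K(1) by blast
qed

section \<open>Linear functionals below a sublinear one\<close>

definition sublinear :: "(real, 'a, 'm) module_scheme \<Rightarrow> ('a \<Rightarrow> real) \<Rightarrow> bool" where
  "sublinear M p \<longleftrightarrow>
     (\<forall>x\<in>carrier M. \<forall>y\<in>carrier M. p (x \<oplus>\<^bsub>M\<^esub> y) \<le> p x + p y) \<and>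
     (\<forall>a>0. \<forall>x\<in>carrier M. p (a \<odot>\<^bsub>M\<^esub> x) \<le> a * p x)"

locale real_module = Module.module real_ring M for M :: "(real, 'a, 'm) module_scheme" (structure)
begin

lemma one_smult [simp]: "x \<in> carrier M \<Longrightarrow> 1 \<odot> x = x"
  using smult_one[of x] by simp

lemma sublinear_add:
  "\<lbrakk>sublinear M p; x \<in> carrier M; y \<in> carrier M\<rbrakk> \<Longrightarrow> p (x \<oplus> y) \<le> p x + p y"
  by (simp add: sublinear_def)

lemma sublinear_scale:
  assumes "sublinear M p" "x \<in> carrier M" "0 < a"
  shows "p (a \<odot> x) = a * p x"
proof (rule antisym)
  have le: "p (b \<odot> z) \<le> b * p z" if "0 < b" "z \<in> carrier M" for b z
    using assms(1) that by (simp add: sublinear_def)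
  show "p (a \<odot> x) \<le> a * p x" using le assms by simp
  have "p ((1 / a) \<odot> (a \<odot> x)) \<le> (1 / a) * p (a \<odot> x)" by (rule le) (use assms in auto)
  moreover have "(1 / a) \<odot> (a \<odot> x) = x" using assms smult_assoc1[of "1 / a" a x] by simp
  ultimately show "a * p x \<le> p (a \<odot> x)" using assms by (simp add: field_simps)
qed

lemma sublinear_zero: "sublinear M p \<Longrightarrow> p \<zero> = 0"
  using sublinear_scale[of p \<zero> 2] by simp

lemma sublinear_neg:
  assumes "sublinear M p" "x \<in> carrier M"
  shows "- p (\<ominus> x) \<le> p x"
  using sublinear_add[of p x "\<ominus> x"] sublinear_zero[of p] assms by (simp add: M.r_neg)

text \<open>
  The largest sublinear function below \<open>p\<close> that agrees with \<open>p\<close> at \<open>y\<close> and is additive along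
  \<open>y\<close>.  A minimal sublinear function cannot be lowered in this way and therefore is additive along
  every \<open>y\<close>.
\<close>

definition additive_along :: "('a \<Rightarrow> real) \<Rightarrow> 'a \<Rightarrow> 'a \<Rightarrow> real" where
  "additive_along p y x = (INF t\<in>{0..}. p (x \<oplus> t \<odot> y) - t * p y)"

context
  fixes p y assumes p: "sublinear M p" and y: "y \<in> carrier M"
begin

lemma additive_along_lower:
  assumes "x \<in> carrier M" "0 \<le> t"
  shows "- p (\<ominus> x) \<le> p (x \<oplus> t \<odot> y) - t * p y"
proof -
  have "t * p y = p (t \<odot> y)"
    using sublinear_scale[OF p y, of t] sublinear_zero[OF p] y assms(2)
    by (cases "t = 0") (use smult_l_null[of y] in auto)
  also have "t \<odot> y = (x \<oplus> t \<odot> y) \<oplus> \<ominus> x"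
    using assms y by (simp add: M.a_assoc M.a_comm[of "t \<odot> y"] M.r_neg1 M.r_neg2)
  also have "p \<dots> \<le> p (x \<oplus> t \<odot> y) + p (\<ominus> x)"
    using assms y by (intro sublinear_add[OF p]) auto
  finally show ?thesis by simp
qed

lemma additive_along_le:
  assumes "x \<in> carrier M" "0 \<le> t"
  shows "additive_along p y x \<le> p (x \<oplus> t \<odot> y) - t * p y"
  unfolding additive_along_def
  by (rule cINF_lower) (use additive_along_lower[OF assms(1)] assms(2) in \<open>auto intro!: bdd_belowI2\<close>)

lemma additive_along_greatest:
  "(\<And>t. 0 \<le> t \<Longrightarrow> c \<le> p (x \<oplus> t \<odot> y) - t * p y) \<Longrightarrow> c \<le> additive_along p y x"
  unfolding additive_along_def by (rule cINF_greatest) auto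

lemma additive_along_below: "x \<in> carrier M \<Longrightarrow> additive_along p y x \<le> p x"
  using additive_along_le[of x 0] smult_l_null[OF y] by simp

lemma additive_along_neg: "additive_along p y (\<ominus> y) \<le> - p y"
  using additive_along_le[of "\<ominus> y" 1] y sublinear_zero[OF p] by (simp add: M.l_neg)

lemma additive_along_sublinear: "sublinear M (additive_along p y)"
  unfolding sublinear_def
proof (intro conjI ballI allI impI)
  fix u v assume u: "u \<in> carrier M" and v: "v \<in> carrier M"
  have le: "additive_along p y (u \<oplus> v) \<le> (p (u \<oplus> s \<odot> y) - s * p y) + (p (v \<oplus> t \<odot> y) - t * p y)"
    if "0 \<le> s" "0 \<le> t" for s t
  proof -
    have eq: "(u \<oplus> v) \<oplus> (s + t) \<odot> y = (u \<oplus> s \<odot> y) \<oplus> (v \<oplus> t \<odot> y)"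
      using u v y smult_l_distr[of s t y]
      by (simp add: M.a_assoc M.a_lcomm[of v "s \<odot> y"])
    have "additive_along p y (u \<oplus> v) \<le> p ((u \<oplus> v) \<oplus> (s + t) \<odot> y) - (s + t) * p y"
      using u v that by (intro additive_along_le) auto
    also have "\<dots> \<le> p (u \<oplus> s \<odot> y) + p (v \<oplus> t \<odot> y) - (s + t) * p y"
      unfolding eq using u v y sublinear_add[OF p] by simp
    finally show ?thesis by (simp add: algebra_simps)
  qed
  have le': "additive_along p y (u \<oplus> v) - (p (u \<oplus> s \<odot> y) - s * p y) \<le> additive_along p y v"
    if "0 \<le> s" for s
  proof (rule additive_along_greatest)
    fix t :: real assume "0 \<le> t"
    then show "additive_along p y (u \<oplus> v) - (p (u \<oplus> s \<odot> y) - s * p y) \<le> p (v \<oplus> t \<odot> y) - t * p y"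
      using le[OF \<open>0 \<le> s\<close>] by fastforce
  qed
  have "additive_along p y (u \<oplus> v) - additive_along p y v \<le> additive_along p y u"
  proof (rule additive_along_greatest)
    fix s :: real assume "0 \<le> s"
    then show "additive_along p y (u \<oplus> v) - additive_along p y v \<le> p (u \<oplus> s \<odot> y) - s * p y"
      using le' by fastforce
  qed
  then show "additive_along p y (u \<oplus> v) \<le> additive_along p y u + additive_along p y v" by simp
next
  fix a :: real and u assume a: "0 < a" and u: "u \<in> carrier M"
  have "additive_along p y (a \<odot> u) / a \<le> p (u \<oplus> t \<odot> y) - t * p y" if "0 \<le> t" for t
  proof -
    have "a \<odot> u \<oplus> (a * t) \<odot> y = a \<odot> (u \<oplus> t \<odot> y)"
      using u y smult_r_distr[of a u "t \<odot> y"] smult_assoc1[of a t y] by simp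
    then have "p (a \<odot> u \<oplus> (a * t) \<odot> y) = a * p (u \<oplus> t \<odot> y)"
      using sublinear_scale[OF p _ a] u y by simp
    then have "additive_along p y (a \<odot> u) \<le> a * p (u \<oplus> t \<odot> y) - a * t * p y"
      using additive_along_le[of "a \<odot> u" "a * t"] u a that by simp
    then show ?thesis using a by (simp add: field_simps)
  qed
  then have "additive_along p y (a \<odot> u) / a \<le> additive_along p y u"
    by (rule additive_along_greatest)
  then show "additive_along p y (a \<odot> u) \<le> a * additive_along p y u"
    using a by (simp add: field_simps)
qed

end

text \<open>Zorn's lemma needs an antisymmetric order, hence functions that vanish off the carrier.\<close>

lemma ex_minimal_sublinear:
  assumes p: "sublinear M p"
  shows "\<exists>q. sublinear M q \<and> (\<forall>x\<in>carrier M. q x \<le> p x) \<and>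
    (\<forall>r. sublinear M r \<longrightarrow> (\<forall>x\<in>carrier M. r x \<le> q x) \<longrightarrow> (\<forall>x\<in>carrier M. r x = q x))"
proof -
  define A where "A = {q. sublinear M q \<and> (\<forall>x\<in>carrier M. q x \<le> p x) \<and> (\<forall>x. x \<notin> carrier M \<longrightarrow> q x = 0)}"
  \<comment> \<open>reversed, since Zorn's lemma yields maximal elements\<close>
  define P where "P q r \<longleftrightarrow> (\<forall>x. r x \<le> q x)" for q r :: "'a \<Rightarrow> real"
  have restrict: "(\<lambda>x. if x \<in> carrier M then q x else 0) \<in> A"
    if "sublinear M q" "\<And>x. x \<in> carrier M \<Longrightarrow> q x \<le> p x" for q
    using that by (auto simp: A_def sublinear_def)
  have "\<exists>m\<in>A. \<forall>a\<in>A. P m a \<longrightarrow> a = m"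
  proof (rule predicate_Zorn)
    show "partial_order_on A (relation_of P A)"
    proof (rule partial_order_on_relation_ofI)
      show "P a a" for a by (simp add: P_def)
      show "P a b \<Longrightarrow> P b c \<Longrightarrow> P a c" for a b c unfolding P_def by (meson order_trans)
      show "P a b \<Longrightarrow> P b a \<Longrightarrow> a = b" for a b unfolding P_def by (meson antisym ext)
    qed
  next
    fix C assume C: "C \<in> Chains (relation_of P A)"
    then have CA: "C \<subseteq> A" and chain: "\<And>q r. \<lbrakk>q \<in> C; r \<in> C\<rbrakk> \<Longrightarrow> P q r \<or> P r q"
      by (auto simp: Chains_def relation_of_def)
    show "\<exists>u\<in>A. \<forall>a\<in>C. P a u"
    proof (cases "C = {}")
      case True
      then show ?thesis using restrict[OF p] by auto
    next
      case False
      have sub: "sublinear M r" if "r \<in> C" for r using that CA by (auto simp: A_def)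
      have below: "r x \<le> p x" if "r \<in> C" "x \<in> carrier M" for r x using that CA by (auto simp: A_def)
      have off: "r x = 0" if "r \<in> C" "x \<notin> carrier M" for r x using that CA by (auto simp: A_def)
      have bdd: "bdd_below ((\<lambda>r. r x) ` C)" if x: "x \<in> carrier M" for x
      proof (rule bdd_belowI2)
        fix r assume r: "r \<in> C"
        then show "- p (\<ominus> x) \<le> r x"
          using sublinear_neg[OF sub[OF r] x] below[OF r, of "\<ominus> x"] x by simp
      qed
      define u where "u x = (if x \<in> carrier M then INF r\<in>C. r x else 0)" for x
      have lower: "u x \<le> r x" if "r \<in> C" for r x
        using cINF_lower[OF bdd that, of x] off[OF that, of x] by (cases "x \<in> carrier M") (auto simp: u_def)
      have greatest: "c \<le> u x" if "x \<in> carrier M" "\<And>r. r \<in> C \<Longrightarrow> c \<le> r x" for c x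
        using False that by (simp add: u_def cINF_greatest)
      have "sublinear M u"
        unfolding sublinear_def
      proof (intro conjI ballI allI impI)
        fix x y assume x: "x \<in> carrier M" and y: "y \<in> carrier M"
        have le: "u (x \<oplus> y) \<le> q x + r y" if q: "q \<in> C" and r: "r \<in> C" for q r
        proof -
          have "\<exists>m\<in>C. m x \<le> q x \<and> m y \<le> r y" using chain[OF q r] q r by (auto simp: P_def)
          then obtain m where m: "m \<in> C" "m x \<le> q x" "m y \<le> r y" by blast
          then show ?thesis
            using lower[of m "x \<oplus> y"] sublinear_add[OF sub[OF m(1)] x y] by linarith
        qed
        have le': "u (x \<oplus> y) - q x \<le> u y" if "q \<in> C" for q
        proof (rule greatest[OF y])
          show "u (x \<oplus> y) - q x \<le> r y" if "r \<in> C" for r using le[OF \<open>q \<in> C\<close> that] by linarith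
        qed
        have "u (x \<oplus> y) - u y \<le> u x"
        proof (rule greatest[OF x])
          show "u (x \<oplus> y) - u y \<le> q x" if "q \<in> C" for q using le'[OF that] by linarith
        qed
        then show "u (x \<oplus> y) \<le> u x + u y" by simp
      next
        fix a :: real and x assume a: "0 < a" and x: "x \<in> carrier M"
        have "u (a \<odot> x) / a \<le> u x"
        proof (rule greatest[OF x])
          show "u (a \<odot> x) / a \<le> r x" if r: "r \<in> C" for r
            using lower[OF r, of "a \<odot> x"] sublinear_scale[OF sub[OF r] x a] a by (simp add: field_simps)
        qed
        then show "u (a \<odot> x) \<le> a * u x" using a by (simp add: field_simps)
      qed
      moreover have "u x \<le> p x" if "x \<in> carrier M" for x
        using False lower below that by (meson all_not_in_conv order_trans)
      ultimately have "u \<in> A" by (simp add: A_def u_def)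
      then show ?thesis using lower by (auto simp: P_def)
    qed
  qed
  then obtain q where q: "q \<in> A" and min: "\<And>a. \<lbrakk>a \<in> A; P q a\<rbrakk> \<Longrightarrow> a = q" by blast
  have "r x = q x" if r: "sublinear M r" "\<forall>x\<in>carrier M. r x \<le> q x" and x: "x \<in> carrier M" for r x
  proof -
    let ?r = "\<lambda>x. if x \<in> carrier M then r x else 0"
    have "?r \<in> A" using q r by (intro restrict) (auto simp: A_def intro: order_trans)
    moreover have "P q ?r" using q r by (auto simp: P_def A_def)
    ultimately have "?r = q" by (rule min)
    then have "?r x = q x" by (rule fun_cong)
    then show ?thesis using x by simp
  qed
  then show ?thesis using q unfolding A_def by blast
qed

text \<open>
  Any minimal sublinear function below \<open>p\<close> is linear.  Searching below \<open>additive_along p v\<close>, whose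
  value at \<open>-v\<close> is at most \<open>- p v\<close>, forces the value \<open>p v\<close> at \<open>v\<close>.
\<close>

theorem hahn_banach:
  assumes p: "sublinear M p" and v: "v \<in> carrier M"
  obtains f where "\<And>x. x \<in> carrier M \<Longrightarrow> f x \<le> p x" "f v = p v"
    "\<And>x y. \<lbrakk>x \<in> carrier M; y \<in> carrier M\<rbrakk> \<Longrightarrow> f (x \<oplus> y) = f x + f y"
    "\<And>a x. x \<in> carrier M \<Longrightarrow> f (a \<odot> x) = a * f x"
proof -
  obtain f where f: "sublinear M f" and below: "\<And>x. x \<in> carrier M \<Longrightarrow> f x \<le> additive_along p v x"
    and min: "\<And>r x. \<lbrakk>sublinear M r; \<forall>x\<in>carrier M. r x \<le> f x; x \<in> carrier M\<rbrakk> \<Longrightarrow> r x = f x"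
    using ex_minimal_sublinear[OF additive_along_sublinear[OF p v]] by blast
  have add: "f (x \<oplus> y) = f x + f y" if x: "x \<in> carrier M" and y: "y \<in> carrier M" for x y
  proof (rule antisym)
    have "additive_along f y x = f x"
      using min[OF additive_along_sublinear[OF f y]] additive_along_below[OF f y] x by simp
    then show "f x + f y \<le> f (x \<oplus> y)" using additive_along_le[OF f y x, of 1] y by simp
  qed (use sublinear_add f x y in auto)
  have neg: "f (\<ominus> x) = - f x" if "x \<in> carrier M" for x
    using add[of x "\<ominus> x"] that sublinear_zero[OF f] by (simp add: M.r_neg)
  have scale: "f (a \<odot> x) = a * f x" if x: "x \<in> carrier M" for a x
  proof -
    consider "a = 0" | "0 < a" | "a < 0" by linarith
    then show ?thesis
    proof cases
      case 1
      then show ?thesis using smult_l_null[OF x] sublinear_zero[OF f] by simp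
    next
      case 2
      then show ?thesis using sublinear_scale[OF f x] by simp
    next
      case 3
      have "a \<odot> x \<oplus> (- a) \<odot> x = \<zero>"
        using smult_l_distr[of a "- a" x] smult_l_null[OF x] x by simp
      then have "f (a \<odot> x) + f ((- a) \<odot> x) = 0"
        using add[of "a \<odot> x" "(- a) \<odot> x"] x sublinear_zero[OF f] by simp
      then show ?thesis using sublinear_scale[OF f x, of "- a"] 3 by simp
    qed
  qed
  have "f v = p v"
  proof (rule antisym)
    show "f v \<le> p v" using below[OF v] additive_along_below[OF p v v] by linarith
    show "p v \<le> f v"
      using below[of "\<ominus> v"] additive_along_neg[OF p v] neg[OF v] v by simp
  qed
  moreover have "f x \<le> p x" if "x \<in> carrier M" for x
    using below[OF that] additive_along_below[OF p v that] by linarith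
  ultimately show thesis using that[of f] add scale by blast
qed

end

section \<open>Ideals of ideals, sums and intersections\<close>

locale solid_subspace = vector_lattice U for U :: "('a, 'm) vlat_scheme" (structure) +
  fixes S :: "'a set"
  assumes sub: "S \<subseteq> carrier U"
    and zero: "\<zero> \<in> S"
    and add: "\<lbrakk>x \<in> S; y \<in> S\<rbrakk> \<Longrightarrow> x \<oplus> y \<in> S"
    and smult: "x \<in> S \<Longrightarrow> a \<odot> x \<in> S"
    and solid_vabs: "\<lbrakk>x \<in> S; y \<in> carrier U; vabs U y \<preceq> vabs U x\<rbrakk> \<Longrightarrow> y \<in> S"
begin

lemma neg: "x \<in> S \<Longrightarrow> \<ominus> x \<in> S"
  using smult[of x "- 1"] neg_smult[of x] sub by auto

lemma solid_positive: "\<lbrakk>x \<in> S; y \<in> carrier U; \<zero> \<preceq> y; y \<preceq> x\<rbrakk> \<Longrightarrow> y \<in> S"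
  using solid_vabs[of x y] vabs_nonneg_eq[of y] vabs_nonneg_eq[of x] sub vle_trans[of \<zero> y x]
  by auto

lemma vabs_in: "x \<in> S \<Longrightarrow> vabs U x \<in> S"
  using solid_vabs[of x "vabs U x"] vabs_nonneg_eq[of "vabs U x"] vabs_bounds[of x] sub by auto

end

lemma (in vector_lattice) solid_subspaceI:
  assumes "S \<subseteq> carrier E" "\<zero> \<in> S" "\<And>x y. \<lbrakk>x \<in> S; y \<in> S\<rbrakk> \<Longrightarrow> x \<oplus> y \<in> S"
    and smult: "\<And>a x. x \<in> S \<Longrightarrow> a \<odot> x \<in> S"
    and majorant: "\<And>x. x \<in> S \<Longrightarrow> \<exists>a\<in>S. x \<preceq> a \<and> \<ominus> x \<preceq> a"
    and solid: "\<And>x y. \<lbrakk>x \<in> S; y \<in> carrier E; \<zero> \<preceq> y; y \<preceq> x\<rbrakk> \<Longrightarrow> y \<in> S"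
  shows "solid_subspace E S"
proof
  fix x y assume x: "x \<in> S" and y: "y \<in> carrier E" and le: "vabs E y \<preceq> vabs E x"
  obtain a where a: "a \<in> S" "x \<preceq> a" "\<ominus> x \<preceq> a" using majorant[OF x] by blast
  then have c: "x \<in> carrier E" "a \<in> carrier E" using x assms(1) by auto
  have ya: "y \<preceq> a" "\<ominus> y \<preceq> a"
    using vabs_bounds[of y] vabs_bounds[of x] le a y c by (meson M.a_inv_closed vle_trans)+
  \<comment> \<open>\<open>y\<close> need not be positive, but \<open>a + y\<close> is and lies below \<open>2a\<close>.\<close>
  have "\<ominus> a \<preceq> y" using ya(2) y c vle_minus_iff[of \<zero> y a] vle_minus_iff[of \<zero> a y]
    by (simp add: M.minus_eq M.a_comm)
  then have "\<zero> \<preceq> a \<oplus> y" using y c vle_minus_iff[of \<zero> a y] by (simp add: M.minus_eq)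
  moreover have "a \<oplus> y \<preceq> a \<oplus> a" using ya y c by (intro vle_add) auto
  ultimately have "a \<oplus> y \<in> S" using solid[of "a \<oplus> a"] a y c assms(3) by simp
  moreover have "\<ominus> a \<in> S" using smult[of a "- 1"] neg_smult[of a] a c by simp
  ultimately have "\<ominus> a \<oplus> (a \<oplus> y) \<in> S" by (rule assms(3)[rotated])
  then show "y \<in> S" using y c by (simp add: M.r_neg1)
qed (use assms in auto)

text \<open>
  Negatives and absolute values are formed inside the carrier of a structure.  A solid subspace
  contains those of \<open>U\<close>, so that both notions agree and an ideal of an ideal of \<open>U\<close> is an ideal
  of \<open>U\<close>.
\<close>

lemma vabs_eq_in_solid:
  fixes U (structure)
  assumes "solid_subspace U (carrier G)" "same_ops G U" and x: "x \<in> carrier G"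
  shows "\<ominus>\<^bsub>G\<^esub> x = \<ominus> x" "vabs G x = vabs U x"
proof -
  interpret solid_subspace U "carrier G" by fact
  have c: "y \<in> carrier U" if "y \<in> carrier G" for y using that sub by auto
  have ops: "\<zero>\<^bsub>G\<^esub> = \<zero>" "\<And>x y. \<lbrakk>x \<in> carrier G; y \<in> carrier G\<rbrakk> \<Longrightarrow> x \<oplus>\<^bsub>G\<^esub> y = x \<oplus> y"
    "\<And>x y. \<lbrakk>x \<in> carrier G; y \<in> carrier G\<rbrakk> \<Longrightarrow> x \<preceq>\<^bsub>G\<^esub> y \<longleftrightarrow> x \<preceq> y"
    using assms(2) by (auto simp: same_ops_def)
  have "(THE y. y \<in> carrier G \<and> x \<oplus>\<^bsub>G\<^esub> y = \<zero>\<^bsub>G\<^esub> \<and> y \<oplus>\<^bsub>G\<^esub> x = \<zero>\<^bsub>G\<^esub>) = \<ominus> x"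
  proof (rule the_equality)
    show "\<ominus> x \<in> carrier G \<and> x \<oplus>\<^bsub>G\<^esub> \<ominus> x = \<zero>\<^bsub>G\<^esub> \<and> \<ominus> x \<oplus>\<^bsub>G\<^esub> x = \<zero>\<^bsub>G\<^esub>"
      using x neg[OF x] c[OF x] by (simp add: ops M.r_neg M.l_neg)
    show "y = \<ominus> x" if "y \<in> carrier G \<and> x \<oplus>\<^bsub>G\<^esub> y = \<zero>\<^bsub>G\<^esub> \<and> y \<oplus>\<^bsub>G\<^esub> x = \<zero>\<^bsub>G\<^esub>" for y
      using that x c[of x] c[of y] M.minus_equality[of y x] ops(2)[of y x] ops(1) by auto
  qed
  then show eq: "\<ominus>\<^bsub>G\<^esub> x = \<ominus> x" by (simp add: a_inv_def m_inv_def)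
  have "vabs G x = vabs U x" if "vabs U x \<in> carrier G"
  proof -
    let ?a = "vabs U x" and ?P = "\<lambda>z. least (vorder G) z (Upper (vorder G) {x, \<ominus>\<^bsub>G\<^esub> x})"
    have P: "?P z \<longleftrightarrow> z \<in> carrier G \<and> x \<preceq> z \<and> \<ominus> x \<preceq> z \<and>
        (\<forall>y\<in>carrier G. x \<preceq> y \<longrightarrow> \<ominus> x \<preceq> y \<longrightarrow> z \<preceq> y)" for z
      using x neg[OF x] by (auto simp: least_def Upper_def eq ops)
    have "?P ?a" using that vabs_bounds[OF c[OF x]] c unfolding P by auto
    moreover have "z = ?a" if "?P z" for z
      using \<open>?P ?a\<close> that c unfolding P by (auto intro: vle_antisym)
    ultimately show ?thesis unfolding vabs_def[of G] join_def Lattice.sup_def by (rule some_equality)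
  qed
  then show "vabs G x = vabs U x" using vabs_in x by blast
qed

lemma order_ideal_iff_solid_subspace:
  fixes U (structure)
  assumes G: "solid_subspace U (carrier G)" "same_ops G U"
  shows "order_ideal F G \<longleftrightarrow> carrier F \<subseteq> carrier G \<and> same_ops F U \<and> solid_subspace U (carrier F)"
proof -
  interpret G: solid_subspace U "carrier G" by fact
  have ops: "\<zero>\<^bsub>G\<^esub> = \<zero>" "\<And>x y. \<lbrakk>x \<in> carrier G; y \<in> carrier G\<rbrakk> \<Longrightarrow> x \<oplus>\<^bsub>G\<^esub> y = x \<oplus> y"
    "\<And>a x. x \<in> carrier G \<Longrightarrow> a \<odot>\<^bsub>G\<^esub> x = a \<odot> x"
    "\<And>x y. \<lbrakk>x \<in> carrier G; y \<in> carrier G\<rbrakk> \<Longrightarrow> x \<preceq>\<^bsub>G\<^esub> y \<longleftrightarrow> x \<preceq> y"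
    using G(2) by (auto simp: same_ops_def)
  note vabs_eq = vabs_eq_in_solid[OF G]
  have same: "same_ops F G \<longleftrightarrow> same_ops F U" if "carrier F \<subseteq> carrier G"
    using that by (auto simp: same_ops_def ops subset_iff)
  have sol: "(\<forall>x\<in>carrier F. \<forall>y\<in>carrier G. vabs G y \<preceq>\<^bsub>G\<^esub> vabs G x \<longrightarrow> y \<in> carrier F)
      \<longleftrightarrow> (\<forall>x\<in>carrier F. \<forall>y\<in>carrier U. vabs U y \<preceq> vabs U x \<longrightarrow> y \<in> carrier F)"
    if FG: "carrier F \<subseteq> carrier G"
  proof -
    have eq: "vabs G y \<preceq>\<^bsub>G\<^esub> vabs G x \<longleftrightarrow> vabs U y \<preceq> vabs U x" if "x \<in> carrier F" "y \<in> carrier G" for x y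
      using that FG vabs_eq(2)[of x] vabs_eq(2)[of y] G.vabs_in[of x] G.vabs_in[of y] ops(4) by auto
    have "y \<in> carrier G" if "x \<in> carrier F" "y \<in> carrier U" "vabs U y \<preceq> vabs U x" for x y
      using that FG G.solid_vabs[of x y] by blast
    then show ?thesis using eq G.sub by blast
  qed
  have submod: "submodule (carrier F) real_ring G \<longleftrightarrow> carrier F \<subseteq> carrier G \<and> \<zero> \<in> carrier F \<and>
      (\<forall>x\<in>carrier F. \<forall>y\<in>carrier F. x \<oplus> y \<in> carrier F) \<and> (\<forall>a. \<forall>x\<in>carrier F. a \<odot> x \<in> carrier F)"
  proof
    assume sm: "submodule (carrier F) real_ring G"
    interpret sm: submodule "carrier F" real_ring G by (rule sm)
    show "carrier F \<subseteq> carrier G \<and> \<zero> \<in> carrier F \<and>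
      (\<forall>x\<in>carrier F. \<forall>y\<in>carrier F. x \<oplus> y \<in> carrier F) \<and> (\<forall>a. \<forall>x\<in>carrier F. a \<odot> x \<in> carrier F)"
    proof (intro conjI ballI allI)
      show sub: "carrier F \<subseteq> carrier G" using sm.subset by simp
      show "\<zero> \<in> carrier F" using sm.one_closed by (simp add: ops)
      show "x \<oplus> y \<in> carrier F" if "x \<in> carrier F" "y \<in> carrier F" for x y
        using sm.m_closed[OF that] ops(2)[OF subsetD[OF sub that(1)] subsetD[OF sub that(2)]] by simp
      show "a \<odot> x \<in> carrier F" if "x \<in> carrier F" for a x
        using sm.smult_closed[OF _ that, of a] ops(3)[OF subsetD[OF sub that], of a] by simp
    qed
  next
    assume R: "carrier F \<subseteq> carrier G \<and> \<zero> \<in> carrier F \<and>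
      (\<forall>x\<in>carrier F. \<forall>y\<in>carrier F. x \<oplus> y \<in> carrier F) \<and> (\<forall>a. \<forall>x\<in>carrier F. a \<odot> x \<in> carrier F)"
    show "submodule (carrier F) real_ring G"
    proof (intro submodule.intro subgroup.intro submodule_axioms.intro)
      fix x assume x: "x \<in> carrier F"
      then have "x \<in> carrier G" "x \<in> carrier U" using R G.sub by auto
      then have "inv\<^bsub>add_monoid G\<^esub> x = (- 1) \<odot> x"
        using vabs_eq(1)[of x] G.neg_smult[of x] by (simp add: a_inv_def)
      then show "inv\<^bsub>add_monoid G\<^esub> x \<in> carrier F" using R x by simp
    qed (use R in \<open>auto simp: ops subset_iff\<close>)
  qed
  have "solid_subspace U (carrier F) \<longleftrightarrow> carrier F \<subseteq> carrier U \<and> \<zero> \<in> carrier F \<and>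
      (\<forall>x\<in>carrier F. \<forall>y\<in>carrier F. x \<oplus> y \<in> carrier F) \<and> (\<forall>a. \<forall>x\<in>carrier F. a \<odot> x \<in> carrier F) \<and>
      (\<forall>x\<in>carrier F. \<forall>y\<in>carrier U. vabs U y \<preceq> vabs U x \<longrightarrow> y \<in> carrier F)"
    using G.vector_lattice_axioms by (auto simp: solid_subspace_def solid_subspace_axioms_def)
  then show ?thesis
    unfolding order_ideal_def submod using same sol G.sub by blast
qed

lemma banach_ideal_iff:
  fixes U (structure)
  assumes "vector_lattice U"
  shows "banach_ideal U I \<longleftrightarrow> banach_lattice I \<and> same_ops I U \<and> solid_subspace U (carrier I)"
proof
  assume "banach_ideal U I"
  then interpret banach_ideal U I .
  have "solid_subspace U (carrier I)"
    by (rule solid_subspaceI) (use subset add_in smult_in solid in \<open>auto elim: majorant\<close>)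
  then show "banach_lattice I \<and> same_ops I U \<and> solid_subspace U (carrier I)"
    using banach ops by simp
next
  assume *: "banach_lattice I \<and> same_ops I U \<and> solid_subspace U (carrier I)"
  then interpret solid_subspace U "carrier I" by simp
  show "banach_ideal U I"
    using * assms sub solid_positive by (simp add: banach_ideal_def banach_ideal_axioms_def)
qed

lemma interpolation_pair_ideals:
  assumes "interpolation_pair U X Y"
  shows "banach_ideal U X" "banach_ideal U Y"
proof -
  have U: "vector_lattice U" using assms by (simp add: interpolation_pair_def)
  interpret vector_lattice U by fact
  have "solid_subspace U (carrier U)"
    by (rule solid_subspaceI) (use vabs_bounds in auto)
  moreover have "same_ops U U" by (simp add: same_ops_def)
  ultimately show "banach_ideal U X" "banach_ideal U Y"
    using assms order_ideal_iff_solid_subspace[of U U]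
    by (auto simp: interpolation_pair_def banach_ideal_iff[OF U])
qed

lemma pair_sum_simps [simp]:
  "zero (pair_sum U X Y) = zero U" "add (pair_sum U X Y) = add U"
  "smult (pair_sum U X Y) = smult U" "vle (pair_sum U X Y) = vle U"
  by (simp_all add: pair_sum_def)

lemma pair_inter_simps [simp]:
  "zero (pair_inter U X Y) = zero U" "add (pair_inter U X Y) = add U"
  "smult (pair_inter U X Y) = smult U" "vle (pair_inter U X Y) = vle U"
  "carrier (pair_inter U X Y) = carrier X \<inter> carrier Y"
  "vnorm (pair_inter U X Y) x = max (\<parallel>x\<parallel>\<^bsub>X\<^esub>) (\<parallel>x\<parallel>\<^bsub>Y\<^esub>)"
  by (simp_all add: pair_inter_def)

text \<open>
  The embedding of \<open>Z\<close> into the sum of \<open>X\<close> and \<open>Y\<close>, with its norm bound, expressed by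
  domination of positive elements.  In this form it can be carried over from one ambient lattice
  to another one (\<open>dominated_transfer\<close> below).
\<close>

definition dominated :: "('a, 'm) vlat_scheme \<Rightarrow> 'a blat \<Rightarrow> 'a blat \<Rightarrow> 'a blat \<Rightarrow> bool" where
  "dominated U X Y Z \<longleftrightarrow> (\<exists>K>0. \<forall>z\<in>pos_cone U \<inter> carrier Z. \<exists>x\<in>pos_cone U \<inter> carrier X.
     \<exists>y\<in>pos_cone U \<inter> carrier Y. z \<preceq>\<^bsub>U\<^esub> x \<oplus>\<^bsub>U\<^esub> y \<and> \<parallel>x\<parallel>\<^bsub>X\<^esub> + \<parallel>y\<parallel>\<^bsub>Y\<^esub> \<le> K * \<parallel>z\<parallel>\<^bsub>Z\<^esub>)"

locale ideal_pair = X: banach_ideal U X + Y: banach_ideal U Y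
  for U :: "'a vlat" (structure) and X Y :: "'a blat"
begin

abbreviation "S \<equiv> carrier (pair_sum U X Y)"

lemma S_def: "S = {x \<oplus> y | x y. x \<in> carrier X \<and> y \<in> carrier Y}"
  by (simp add: pair_sum_def)

lemma sumI: "\<lbrakk>x \<in> carrier X; y \<in> carrier Y\<rbrakk> \<Longrightarrow> x \<oplus> y \<in> S"
  by (auto simp: S_def)

lemma X_in_S: "x \<in> carrier X \<Longrightarrow> x \<in> S"
  using sumI[of x \<zero>] X.in_carrier by simp

lemma Y_in_S: "y \<in> carrier Y \<Longrightarrow> y \<in> S"
  using sumI[of \<zero> y] Y.in_carrier by simp

lemma sum_solid: "solid_subspace U S"
proof (rule X.solid_subspaceI)
  show "S \<subseteq> carrier U" using X.in_carrier Y.in_carrier by (auto simp: S_def)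
  show "\<zero> \<in> S" by (rule X_in_S) simp
  fix u assume u: "u \<in> S"
  then obtain x y where xy: "x \<in> carrier X" "y \<in> carrier Y" "u = x \<oplus> y" by (auto simp: S_def)
  note c = X.in_carrier[OF xy(1)] Y.in_carrier[OF xy(2)]
  show "a \<odot> u \<in> S" for a
    using xy c sumI[of "a \<odot> x" "a \<odot> y"] X.smult_in Y.smult_in X.smult_r_distr[of a x y] by simp
  show "u \<oplus> v \<in> S" if "v \<in> S" for v
  proof -
    obtain x' y' where xy': "x' \<in> carrier X" "y' \<in> carrier Y" "v = x' \<oplus> y'"
      using \<open>v \<in> S\<close> by (auto simp: S_def)
    note c' = X.in_carrier[OF xy'(1)] Y.in_carrier[OF xy'(2)]
    have "u \<oplus> v = (x \<oplus> x') \<oplus> (y \<oplus> y')"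
      using c c' by (simp add: xy xy' X.M.a_assoc X.M.a_lcomm[of y])
    then show ?thesis using xy xy' sumI[of "x \<oplus> x'" "y \<oplus> y'"] X.add_in Y.add_in by simp
  qed
  obtain a where a: "a \<in> carrier X" "x \<preceq> a" "\<ominus> x \<preceq> a" using X.majorant[OF xy(1)] by metis
  obtain b where b: "b \<in> carrier Y" "y \<preceq> b" "\<ominus> y \<preceq> b" using Y.majorant[OF xy(2)] by metis
  note ab = X.in_carrier[OF a(1)] Y.in_carrier[OF b(1)]
  have ub: "u \<preceq> a \<oplus> b" "\<ominus> u \<preceq> a \<oplus> b"
    using a b ab c by (auto simp: xy X.M.minus_add intro!: X.vle_add)
  then show "\<exists>a\<in>S. u \<preceq> a \<and> \<ominus> u \<preceq> a" using a b sumI by blast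
  fix v assume v: "v \<in> carrier U" "\<zero> \<preceq> v" "v \<preceq> u"
  have uc: "u \<in> carrier U" using xy c by simp
  have va: "v \<preceq> a \<oplus> b" using v ub uc ab by (meson X.M.a_closed X.vle_trans)
  have a0: "\<zero> \<preceq> a" "\<zero> \<preceq> b"
    using X.nonneg_of_symmetric a b ab c by blast+
  obtain b' where b': "b' \<in> carrier U" "\<zero> \<preceq> b'" "b' \<preceq> v" "v \<preceq> a \<oplus> b'"
      "b' \<preceq> b"
    using X.truncation[of v a] v va a0 ab by metis
  have "b' \<in> carrier Y" using Y.solid b b' by blast
  moreover have "v \<ominus> b' \<in> carrier X"
    using a v b' ab X.solid[of a "v \<ominus> b'"]
    by (simp add: X.minus_nonneg_iff X.vle_minus_iff X.M.a_comm)
  moreover have "v = (v \<ominus> b') \<oplus> b'"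
    using v b' by (simp add: X.M.minus_eq X.M.a_assoc X.M.l_neg)
  ultimately show "v \<in> S" using sumI by metis
qed

lemma positive_in_sum:
  assumes "z \<in> S" "\<zero> \<preceq> z"
  obtains x y where "x \<in> carrier X" "y \<in> carrier Y" "\<zero> \<preceq> x" "\<zero> \<preceq> y" "z \<preceq> x \<oplus> y"
proof -
  obtain x y where xy: "x \<in> carrier X" "y \<in> carrier Y" "z = x \<oplus> y" using assms by (auto simp: S_def)
  obtain a where a: "a \<in> carrier X" "\<zero> \<preceq> a" "x \<preceq> a" using X.majorant[OF xy(1)] by metis
  obtain b where b: "b \<in> carrier Y" "\<zero> \<preceq> b" "y \<preceq> b" using Y.majorant[OF xy(2)] by metis
  have "z \<preceq> a \<oplus> b" using a b xy X.in_carrier Y.in_carrier by (auto intro: X.vle_add)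
  then show thesis using that a b by blast
qed

lemma sum_norm_bdd: "bdd_below {\<parallel>x\<parallel>\<^bsub>X\<^esub> + \<parallel>y\<parallel>\<^bsub>Y\<^esub> | x y. x \<in> carrier X \<and> y \<in> carrier Y \<and> z = x \<oplus> y}"
  by (rule bdd_belowI[of _ 0]) (use X.I.norm_nonneg Y.I.norm_nonneg in fastforce)

lemma sum_norm_le:
  "\<lbrakk>x \<in> carrier X; y \<in> carrier Y\<rbrakk> \<Longrightarrow> vnorm (pair_sum U X Y) (x \<oplus> y) \<le> \<parallel>x\<parallel>\<^bsub>X\<^esub> + \<parallel>y\<parallel>\<^bsub>Y\<^esub>"
  unfolding pair_sum_def using sum_norm_bdd by (auto intro!: cInf_lower)

lemma sum_norm_less:
  assumes "z \<in> S" "vnorm (pair_sum U X Y) z < c"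
  obtains x y where "x \<in> carrier X" "y \<in> carrier Y" "z = x \<oplus> y" "\<parallel>x\<parallel>\<^bsub>X\<^esub> + \<parallel>y\<parallel>\<^bsub>Y\<^esub> < c"
proof -
  let ?N = "{\<parallel>x\<parallel>\<^bsub>X\<^esub> + \<parallel>y\<parallel>\<^bsub>Y\<^esub> | x y. x \<in> carrier X \<and> y \<in> carrier Y \<and> z = x \<oplus> y}"
  have "?N \<noteq> {}" using assms(1) by (auto simp: S_def)
  moreover have "Inf ?N < c" using assms(2) by (simp add: pair_sum_def)
  ultimately have "\<exists>r\<in>?N. r < c" by (rule cInf_lessD)
  then show thesis using that by auto
qed

lemma intermediate_iff:
  assumes "banach_ideal U Z"
  shows "intermediate U X Y Z \<longleftrightarrow> carrier X \<inter> carrier Y \<subseteq> carrier Z \<and> carrier Z \<subseteq> S \<and>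
     (\<exists>c>0. \<forall>x\<in>carrier X \<inter> carrier Y. \<parallel>x\<parallel>\<^bsub>Z\<^esub> \<le> c * max (\<parallel>x\<parallel>\<^bsub>X\<^esub>) (\<parallel>x\<parallel>\<^bsub>Y\<^esub>)) \<and>
     (\<exists>c>0. \<forall>z\<in>carrier Z. vnorm (pair_sum U X Y) z \<le> c * \<parallel>z\<parallel>\<^bsub>Z\<^esub>)"
proof -
  have ideals: "solid_subspace U (carrier I) \<and> same_ops I U" if "banach_ideal U I" for I :: "'a blat"
    using that banach_ideal_iff[OF X.vector_lattice_axioms] by blast
  note X = ideals[OF X.banach_ideal_axioms] and Y = ideals[OF Y.banach_ideal_axioms]
    and Z = ideals[OF assms]
  have inter: "order_ideal (pair_inter U X Y) Z \<longleftrightarrow> carrier X \<inter> carrier Y \<subseteq> carrier Z"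
  proof -
    have "solid_subspace U (carrier X \<inter> carrier Y)"
    proof (intro solid_subspace.intro solid_subspace_axioms.intro X.vector_lattice_axioms)
      interpret SX: solid_subspace U "carrier X" using X by simp
      interpret SY: solid_subspace U "carrier Y" using Y by simp
      show "y \<in> carrier X \<inter> carrier Y" if "x \<in> carrier X \<inter> carrier Y" "y \<in> carrier U" "vabs U y \<preceq> vabs U x" for x y
        using that SX.solid_vabs SY.solid_vabs by blast
    qed (use X.subset X.add_in Y.add_in X.smult_in Y.smult_in in auto)
    moreover have "same_ops (pair_inter U X Y) U" by (simp add: same_ops_def)
    ultimately show ?thesis using order_ideal_iff_solid_subspace[of U Z "pair_inter U X Y"] Z by simp
  qed
  have sum: "order_ideal Z (pair_sum U X Y) \<longleftrightarrow> carrier Z \<subseteq> S"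
  proof -
    have "same_ops (pair_sum U X Y) U" by (simp add: same_ops_def)
    then show ?thesis using order_ideal_iff_solid_subspace[OF sum_solid, of Z] Z by simp
  qed
  show ?thesis
    unfolding intermediate_def embeds_def inter sum
    using banach_ideal.banach[OF assms] by simp blast
qed

lemma intermediate_ideal:
  assumes "intermediate U X Y Z"
  shows "banach_ideal U Z"
proof -
  have "same_ops (pair_sum U X Y) U" by (simp add: same_ops_def)
  then show ?thesis
    using assms order_ideal_iff_solid_subspace[OF sum_solid, of Z]
    by (auto simp: intermediate_def embeds_def banach_ideal_iff[OF X.vector_lattice_axioms])
qed

lemma intermediate_dominated:
  assumes "intermediate U X Y Z"
  shows "dominated U X Y Z"
proof -
  interpret Z: banach_ideal U Z by (rule intermediate_ideal) fact
  obtain c where c: "0 < c" "\<And>z. z \<in> carrier Z \<Longrightarrow> vnorm (pair_sum U X Y) z \<le> c * \<parallel>z\<parallel>\<^bsub>Z\<^esub>"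
    and sub: "carrier Z \<subseteq> S"
    using assms intermediate_iff[OF Z.banach_ideal_axioms] by blast
  have "\<exists>x\<in>pos_cone U \<inter> carrier X. \<exists>y\<in>pos_cone U \<inter> carrier Y.
      z \<preceq> x \<oplus> y \<and> \<parallel>x\<parallel>\<^bsub>X\<^esub> + \<parallel>y\<parallel>\<^bsub>Y\<^esub> \<le> (c + 1) * \<parallel>z\<parallel>\<^bsub>Z\<^esub>" if z: "z \<in> carrier Z" "\<zero> \<preceq> z" for z
  proof (cases "z = \<zero>")
    case True
    then show ?thesis by (intro bexI[of _ \<zero>]) (auto simp: pos_cone_def)
  next
    case False
    then have "0 < \<parallel>z\<parallel>\<^bsub>Z\<^esub>" using Z.norm_0_iff[OF z(1)] Z.I.norm_nonneg[OF z(1)] by linarith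
    then have "vnorm (pair_sum U X Y) z < (c + 1) * \<parallel>z\<parallel>\<^bsub>Z\<^esub>"
      using c(2)[OF z(1)] by (simp add: algebra_simps)
    then obtain x y where xy: "x \<in> carrier X" "y \<in> carrier Y" "z = x \<oplus> y"
        "\<parallel>x\<parallel>\<^bsub>X\<^esub> + \<parallel>y\<parallel>\<^bsub>Y\<^esub> < (c + 1) * \<parallel>z\<parallel>\<^bsub>Z\<^esub>"
      using sum_norm_less z sub by blast
    obtain a where a: "a \<in> carrier X" "\<zero> \<preceq> a" "x \<preceq> a" "\<parallel>a\<parallel>\<^bsub>X\<^esub> = \<parallel>x\<parallel>\<^bsub>X\<^esub>"
      using X.majorant[OF xy(1)] by metis
    obtain b where b: "b \<in> carrier Y" "\<zero> \<preceq> b" "y \<preceq> b" "\<parallel>b\<parallel>\<^bsub>Y\<^esub> = \<parallel>y\<parallel>\<^bsub>Y\<^esub>"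
      using Y.majorant[OF xy(2)] by metis
    have "z \<preceq> a \<oplus> b" using a b xy X.in_carrier Y.in_carrier by (auto intro: X.vle_add)
    then show ?thesis using a b xy X.in_carrier Y.in_carrier
      by (intro bexI[of _ a] bexI[of _ b]) (auto simp: pos_cone_def)
  qed
  then show ?thesis unfolding dominated_def
    using c(1) by (intro exI[of _ "c + 1"]) (auto simp: pos_cone_def)
qed

lemma left_in_P_Int: "X \<in> P_Int U X Y"
proof -
  have "intermediate U X Y X"
    unfolding intermediate_iff[OF X.banach_ideal_axioms]
  proof (intro conjI exI[of _ 1] ballI)
    show "carrier X \<subseteq> S" using X_in_S by blast
    show "vnorm (pair_sum U X Y) x \<le> 1 * \<parallel>x\<parallel>\<^bsub>X\<^esub>" if "x \<in> carrier X" for x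
      using sum_norm_le[OF that Y.zero_in] X.in_carrier[OF that] by simp
  qed auto
  moreover have "T ` carrier X \<subseteq> carrier X" if "T \<in> pos_ops X" for T
    using that by (auto simp: pos_ops_def linear_op_def hom_def)
  ultimately have "X \<in> P_Int_const 1 U X Y"
    by (auto simp: P_Int_const_def pair_pos_ops_def)
  then show ?thesis unfolding P_Int_def by (intro UN_I[of 1]) auto
qed

lemma pair_sum_commute: "pair_sum U Y X = pair_sum U X Y"
proof -
  have "{x \<oplus> y | x y. x \<in> carrier Y \<and> y \<in> carrier X} = {x \<oplus> y | x y. x \<in> carrier X \<and> y \<in> carrier Y}"
    using X.in_carrier Y.in_carrier X.M.a_comm by (auto, blast+)
  moreover have "{\<parallel>x\<parallel>\<^bsub>Y\<^esub> + \<parallel>y\<parallel>\<^bsub>X\<^esub> | x y. x \<in> carrier Y \<and> y \<in> carrier X \<and> z = x \<oplus> y} =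
      {\<parallel>x\<parallel>\<^bsub>X\<^esub> + \<parallel>y\<parallel>\<^bsub>Y\<^esub> | x y. x \<in> carrier X \<and> y \<in> carrier Y \<and> z = x \<oplus> y}" for z
    using X.in_carrier Y.in_carrier X.M.a_comm by (auto, metis add.commute, metis add.commute)
  ultimately show ?thesis by (simp add: pair_sum_def)
qed

lemma P_Int_commute: "P_Int U Y X = P_Int U X Y"
proof -
  have "pair_inter U Y X = pair_inter U X Y"
    by (simp add: pair_inter_def Int_commute max.commute)
  then show ?thesis
    unfolding P_Int_def P_Int_const_def intermediate_def pair_pos_ops_def pair_sum_commute
    by (simp add: max.commute conj_commute)
qed

end

section \<open>Positive functionals and operators of rank one\<close>

context ideal_pair
begin

text \<open>
  The \<open>K\<close>-functional of the pair, in a form that is monotone and vanishes on negative elements: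
  linear functionals below it are positive.  For \<open>\<epsilon> = 0\<close> it measures the distance from \<open>Y\<close>.
\<close>

definition gauge :: "real \<Rightarrow> 'a \<Rightarrow> real" where
  "gauge \<epsilon> s = Inf {\<parallel>x\<parallel>\<^bsub>X\<^esub> + \<epsilon> * \<parallel>y\<parallel>\<^bsub>Y\<^esub> | x y.
     x \<in> carrier X \<and> y \<in> carrier Y \<and> \<zero> \<preceq> x \<and> \<zero> \<preceq> y \<and> s \<preceq> x \<oplus> y}"

definition positive_functional :: "('a \<Rightarrow> real) \<Rightarrow> bool" where
  "positive_functional f \<longleftrightarrow> (\<forall>x\<in>S. \<forall>y\<in>S. f (x \<oplus> y) = f x + f y) \<and>
     (\<forall>a. \<forall>x\<in>S. f (a \<odot> x) = a * f x) \<and> (\<forall>x\<in>S. \<zero> \<preceq> x \<longrightarrow> 0 \<le> f x)"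

lemma positive_functionalD:
  assumes "positive_functional f"
  shows "\<lbrakk>x \<in> S; y \<in> S\<rbrakk> \<Longrightarrow> f (x \<oplus> y) = f x + f y" "x \<in> S \<Longrightarrow> f (a \<odot> x) = a * f x"
    "\<lbrakk>x \<in> S; \<zero> \<preceq> x\<rbrakk> \<Longrightarrow> 0 \<le> f x"
  using assms unfolding positive_functional_def by blast+

lemma S_carrier: "x \<in> S \<Longrightarrow> x \<in> carrier U"
  using solid_subspace.sub[OF sum_solid] by blast

lemma gauge_le:
  assumes "0 \<le> \<epsilon>" "x \<in> carrier X" "y \<in> carrier Y" "\<zero> \<preceq> x" "\<zero> \<preceq> y" "s \<preceq> x \<oplus> y"
  shows "gauge \<epsilon> s \<le> \<parallel>x\<parallel>\<^bsub>X\<^esub> + \<epsilon> * \<parallel>y\<parallel>\<^bsub>Y\<^esub>"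
  unfolding gauge_def
proof (rule cInf_lower)
  show "bdd_below {\<parallel>x\<parallel>\<^bsub>X\<^esub> + \<epsilon> * \<parallel>y\<parallel>\<^bsub>Y\<^esub> | x y.
     x \<in> carrier X \<and> y \<in> carrier Y \<and> \<zero> \<preceq> x \<and> \<zero> \<preceq> y \<and> s \<preceq> x \<oplus> y}"
    using assms(1) X.I.norm_nonneg Y.I.norm_nonneg by (intro bdd_belowI[of _ 0]) fastforce
qed (use assms in blast)

lemma ex_majorant_sum:
  assumes "s \<in> S"
  obtains x y where "x \<in> carrier X" "y \<in> carrier Y" "\<zero> \<preceq> x" "\<zero> \<preceq> y" "s \<preceq> x \<oplus> y"
proof -
  interpret solid_subspace U S by (rule sum_solid)
  obtain x y where "x \<in> carrier X" "y \<in> carrier Y" "\<zero> \<preceq> x" "\<zero> \<preceq> y" and le: "vabs U s \<preceq> x \<oplus> y"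
    using positive_in_sum[of "vabs U s"] vabs_in[OF assms] X.vabs_bounds[of s] S_carrier[OF assms]
    by metis
  moreover have "s \<preceq> x \<oplus> y"
    using le X.vabs_bounds[of s] S_carrier[OF assms] calculation X.in_carrier Y.in_carrier
    by (meson X.M.a_closed X.vle_trans)
  ultimately show thesis using that by blast
qed

lemma gauge_greatest:
  assumes "s \<in> S"
    and "\<And>x y. \<lbrakk>x \<in> carrier X; y \<in> carrier Y; \<zero> \<preceq> x; \<zero> \<preceq> y; s \<preceq> x \<oplus> y\<rbrakk> \<Longrightarrow> c \<le> \<parallel>x\<parallel>\<^bsub>X\<^esub> + \<epsilon> * \<parallel>y\<parallel>\<^bsub>Y\<^esub>"
  shows "c \<le> gauge \<epsilon> s"
  unfolding gauge_def
proof (rule cInf_greatest)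
  obtain x y where "x \<in> carrier X" "y \<in> carrier Y" "\<zero> \<preceq> x" "\<zero> \<preceq> y" "s \<preceq> x \<oplus> y"
    by (rule ex_majorant_sum[OF assms(1)])
  then show "{\<parallel>x\<parallel>\<^bsub>X\<^esub> + \<epsilon> * \<parallel>y\<parallel>\<^bsub>Y\<^esub> | x y.
     x \<in> carrier X \<and> y \<in> carrier Y \<and> \<zero> \<preceq> x \<and> \<zero> \<preceq> y \<and> s \<preceq> x \<oplus> y} \<noteq> {}"
    by blast
qed (use assms(2) in blast)

lemma gauge_less:
  assumes "s \<in> S" "gauge \<epsilon> s < c"
  obtains x y where "x \<in> carrier X" "y \<in> carrier Y" "\<zero> \<preceq> x" "\<zero> \<preceq> y" "s \<preceq> x \<oplus> y"
    "\<parallel>x\<parallel>\<^bsub>X\<^esub> + \<epsilon> * \<parallel>y\<parallel>\<^bsub>Y\<^esub> < c"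
proof (rule ccontr)
  note * = that
  assume "\<not> thesis"
  then have "c \<le> \<parallel>x\<parallel>\<^bsub>X\<^esub> + \<epsilon> * \<parallel>y\<parallel>\<^bsub>Y\<^esub>"
    if "x \<in> carrier X" "y \<in> carrier Y" "\<zero> \<preceq> x" "\<zero> \<preceq> y" "s \<preceq> x \<oplus> y" for x y
    using *[OF that] by (rule contrapos_np) (simp add: not_le)
  then have "c \<le> gauge \<epsilon> s" by (rule gauge_greatest[OF assms(1)])
  then show False using assms(2) by simp
qed

lemma gauge_mono_eps:
  assumes "s \<in> S" "0 \<le> \<epsilon>" "\<epsilon> \<le> \<epsilon>'"
  shows "gauge \<epsilon> s \<le> gauge \<epsilon>' s"
proof (rule gauge_greatest[OF assms(1)])
  fix x y assume xy: "x \<in> carrier X" "y \<in> carrier Y" "\<zero> \<preceq> x" "\<zero> \<preceq> y" "s \<preceq> x \<oplus> y"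
  then have "\<epsilon> * \<parallel>y\<parallel>\<^bsub>Y\<^esub> \<le> \<epsilon>' * \<parallel>y\<parallel>\<^bsub>Y\<^esub>" using assms Y.I.norm_nonneg by (intro mult_right_mono) auto
  then show "gauge \<epsilon> s \<le> \<parallel>x\<parallel>\<^bsub>X\<^esub> + \<epsilon>' * \<parallel>y\<parallel>\<^bsub>Y\<^esub>" using gauge_le[OF assms(2) xy] by linarith
qed

lemma gauge_X: "\<lbrakk>x \<in> carrier X; \<zero> \<preceq> x; 0 \<le> \<epsilon>\<rbrakk> \<Longrightarrow> gauge \<epsilon> x \<le> \<parallel>x\<parallel>\<^bsub>X\<^esub>"
  using gauge_le[of \<epsilon> x \<zero> x] X.in_carrier[of x] by simp

lemma gauge_Y: "\<lbrakk>y \<in> carrier Y; \<zero> \<preceq> y; 0 \<le> \<epsilon>\<rbrakk> \<Longrightarrow> gauge \<epsilon> y \<le> \<epsilon> * \<parallel>y\<parallel>\<^bsub>Y\<^esub>"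
  using gauge_le[of \<epsilon> \<zero> y y] Y.in_carrier[of y] by simp

lemma gauge_nonpos: "\<lbrakk>s \<preceq> \<zero>; 0 \<le> \<epsilon>\<rbrakk> \<Longrightarrow> gauge \<epsilon> s \<le> 0"
  using gauge_le[of \<epsilon> \<zero> \<zero> s] by simp

lemma gauge_add_le:
  assumes "s \<in> carrier U" "s' \<in> S" "s'' \<in> S" "s \<preceq> s' \<oplus> s''" "0 \<le> \<epsilon>"
  shows "gauge \<epsilon> s \<le> gauge \<epsilon> s' + gauge \<epsilon> s''"
proof -
  have le: "gauge \<epsilon> s \<le> (\<parallel>x\<parallel>\<^bsub>X\<^esub> + \<epsilon> * \<parallel>y\<parallel>\<^bsub>Y\<^esub>) + (\<parallel>x'\<parallel>\<^bsub>X\<^esub> + \<epsilon> * \<parallel>y'\<parallel>\<^bsub>Y\<^esub>)"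
    if xy: "x \<in> carrier X" "y \<in> carrier Y" "\<zero> \<preceq> x" "\<zero> \<preceq> y" "s' \<preceq> x \<oplus> y"
      and xy': "x' \<in> carrier X" "y' \<in> carrier Y" "\<zero> \<preceq> x'" "\<zero> \<preceq> y'" "s'' \<preceq> x' \<oplus> y'" for x y x' y'
  proof -
    note c = xy(1) xy'(1) xy(2) xy'(2)
    note cU = xy(1)[THEN X.in_carrier] xy'(1)[THEN X.in_carrier] xy(2)[THEN Y.in_carrier]
      xy'(2)[THEN Y.in_carrier] assms(2)[THEN S_carrier] assms(3)[THEN S_carrier]
    have "s' \<oplus> s'' \<preceq> (x \<oplus> y) \<oplus> (x' \<oplus> y')" using xy xy' cU by (intro X.vle_add) auto
    then have "s \<preceq> (x \<oplus> y) \<oplus> (x' \<oplus> y')" using assms cU by (meson X.M.a_closed X.vle_trans)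
    also have "(x \<oplus> y) \<oplus> (x' \<oplus> y') = (x \<oplus> x') \<oplus> (y \<oplus> y')"
      using cU by (simp add: X.M.a_assoc X.M.a_lcomm[of y])
    finally have "gauge \<epsilon> s \<le> \<parallel>x \<oplus> x'\<parallel>\<^bsub>X\<^esub> + \<epsilon> * \<parallel>y \<oplus> y'\<parallel>\<^bsub>Y\<^esub>"
      using c cU xy xy' assms(5) by (intro gauge_le X.add_nonneg X.add_in Y.add_in) auto
    moreover have "\<epsilon> * \<parallel>y \<oplus> y'\<parallel>\<^bsub>Y\<^esub> \<le> \<epsilon> * (\<parallel>y\<parallel>\<^bsub>Y\<^esub> + \<parallel>y'\<parallel>\<^bsub>Y\<^esub>)"
      using Y.norm_add[OF xy(2) xy'(2)] assms(5) by (rule mult_left_mono)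
    ultimately show ?thesis using X.norm_add[OF xy(1) xy'(1)] by (simp add: distrib_left)
  qed
  have le': "gauge \<epsilon> s - (\<parallel>x\<parallel>\<^bsub>X\<^esub> + \<epsilon> * \<parallel>y\<parallel>\<^bsub>Y\<^esub>) \<le> gauge \<epsilon> s''"
    if "x \<in> carrier X" "y \<in> carrier Y" "\<zero> \<preceq> x" "\<zero> \<preceq> y" "s' \<preceq> x \<oplus> y" for x y
    by (rule gauge_greatest[OF assms(3)]) (use le[OF that] in fastforce)
  have "gauge \<epsilon> s - gauge \<epsilon> s'' \<le> gauge \<epsilon> s'"
    by (rule gauge_greatest[OF assms(2)]) (use le' in fastforce)
  then show ?thesis by simp
qed

lemma gauge_scale_le:
  assumes "s \<in> S" "0 < a" "0 \<le> \<epsilon>"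
  shows "gauge \<epsilon> (a \<odot> s) \<le> a * gauge \<epsilon> s"
proof -
  have "gauge \<epsilon> (a \<odot> s) / a \<le> gauge \<epsilon> s"
  proof (rule gauge_greatest[OF assms(1)])
    fix x y assume xy: "x \<in> carrier X" "y \<in> carrier Y" "\<zero> \<preceq> x" "\<zero> \<preceq> y" "s \<preceq> x \<oplus> y"
    note c = X.in_carrier[OF xy(1)] Y.in_carrier[OF xy(2)] S_carrier[OF assms(1)]
    have "a \<odot> s \<preceq> a \<odot> (x \<oplus> y)" using X.smult_mono[of s "x \<oplus> y" a] xy c assms(2) by simp
    also have "a \<odot> (x \<oplus> y) = a \<odot> x \<oplus> a \<odot> y" using X.smult_r_distr[of a x y] c by simp
    finally have "gauge \<epsilon> (a \<odot> s) \<le> \<parallel>a \<odot> x\<parallel>\<^bsub>X\<^esub> + \<epsilon> * \<parallel>a \<odot> y\<parallel>\<^bsub>Y\<^esub>"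
      using xy c assms by (intro gauge_le X.smult_in Y.smult_in X.smult_nonneg) auto
    then show "gauge \<epsilon> (a \<odot> s) / a \<le> \<parallel>x\<parallel>\<^bsub>X\<^esub> + \<epsilon> * \<parallel>y\<parallel>\<^bsub>Y\<^esub>"
      using assms(2) X.norm_scale[OF xy(1)] Y.norm_scale[OF xy(2)] by (simp add: field_simps)
  qed
  then show ?thesis using assms(2) by (simp add: field_simps)
qed

lemma ex_positive_functional:
  assumes v: "v \<in> S" and e: "0 \<le> \<epsilon>"
  obtains f where "positive_functional f" "f v = gauge \<epsilon> v"
    "\<And>x. \<lbrakk>x \<in> carrier X; \<zero> \<preceq> x\<rbrakk> \<Longrightarrow> f x \<le> \<parallel>x\<parallel>\<^bsub>X\<^esub>"
    "\<And>y. \<lbrakk>y \<in> carrier Y; \<zero> \<preceq> y\<rbrakk> \<Longrightarrow> f y \<le> \<epsilon> * \<parallel>y\<parallel>\<^bsub>Y\<^esub>"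
proof -
  interpret S: solid_subspace U S by (rule sum_solid)
  have "submodule S real_ring U"
    using S.sub S.zero S.add S.smult S.neg by (intro X.submoduleI) auto
  then have "Module.module real_ring (U\<lparr>carrier := S\<rparr>)"
    by (rule submodule.submodule_is_module) (rule X.module_axioms)
  then interpret M: real_module "U\<lparr>carrier := S\<rparr>" by (simp add: real_module_def)
  have "sublinear (U\<lparr>carrier := S\<rparr>) (gauge \<epsilon>)"
    using gauge_add_le[OF _ _ _ _ e] gauge_scale_le[OF _ _ e] S.add S_carrier
    by (auto simp: sublinear_def)
  then obtain f where f: "\<And>x. x \<in> S \<Longrightarrow> f x \<le> gauge \<epsilon> x" "f v = gauge \<epsilon> v"
    "\<And>x y. \<lbrakk>x \<in> S; y \<in> S\<rbrakk> \<Longrightarrow> f (x \<oplus> y) = f x + f y"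
    "\<And>a x. x \<in> S \<Longrightarrow> f (a \<odot> x) = a * f x"
    using M.hahn_banach[of "gauge \<epsilon>" v] v by auto
  have "0 \<le> f x" if x: "x \<in> S" "\<zero> \<preceq> x" for x
  proof -
    have "\<ominus> x \<preceq> \<zero>" using x X.vle_minus_iff[of \<zero> x \<zero>] S_carrier by (simp add: X.M.minus_eq)
    then have "f ((- 1) \<odot> x) \<le> 0"
      using f(1)[of "\<ominus> x"] gauge_nonpos[of "\<ominus> x", OF _ e] S.neg x X.neg_smult[of x] S_carrier
      by fastforce
    then show ?thesis using f(4)[OF x(1), of "- 1"] by simp
  qed
  then have "positive_functional f" using f by (simp add: positive_functional_def)
  moreover have "f x \<le> \<parallel>x\<parallel>\<^bsub>X\<^esub>" if "x \<in> carrier X" "\<zero> \<preceq> x" for x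
    using f(1)[OF X_in_S[OF that(1)]] gauge_X[OF that e] by linarith
  moreover have "f y \<le> \<epsilon> * \<parallel>y\<parallel>\<^bsub>Y\<^esub>" if "y \<in> carrier Y" "\<zero> \<preceq> y" for y
    using f(1)[OF Y_in_S[OF that(1)]] gauge_Y[OF that e] by linarith
  ultimately show thesis using that[of f] f(2) by blast
qed

lemma positive_functional_bound:
  assumes f: "positive_functional f" and I: "banach_ideal U I" "carrier I \<subseteq> S"
    and le: "\<And>x. \<lbrakk>x \<in> carrier I; \<zero> \<preceq> x\<rbrakk> \<Longrightarrow> f x \<le> C * \<parallel>x\<parallel>\<^bsub>I\<^esub>"
    and x: "x \<in> carrier I"
  shows "\<bar>f x\<bar> \<le> C * \<parallel>x\<parallel>\<^bsub>I\<^esub>"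
proof -
  interpret I: banach_ideal U I by fact
  have mono: "f y \<le> f a" if "y \<in> carrier I" "a \<in> carrier I" "y \<preceq> a" for y a
  proof -
    have d: "a \<ominus> y \<in> carrier I" "\<zero> \<preceq> a \<ominus> y"
      using that I.minus_in X.minus_nonneg_iff I.in_carrier by auto
    have "(a \<ominus> y) \<oplus> y = a" using that I.in_carrier by (simp add: X.M.minus_eq X.M.a_assoc X.M.l_neg)
    moreover have "f ((a \<ominus> y) \<oplus> y) = f (a \<ominus> y) + f y" "0 \<le> f (a \<ominus> y)"
      using positive_functionalD[OF f] d that subsetD[OF I(2)] by simp_all
    ultimately show ?thesis by simp
  qed
  obtain a where a: "a \<in> carrier I" "\<zero> \<preceq> a" "x \<preceq> a" "\<ominus> x \<preceq> a" "\<parallel>a\<parallel>\<^bsub>I\<^esub> = \<parallel>x\<parallel>\<^bsub>I\<^esub>"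
    by (rule I.majorant[OF x])
  have "f (\<ominus> x) = - f x"
    using positive_functionalD(2)[OF f subsetD[OF I(2) x], of "- 1"] X.neg_smult[OF I.in_carrier[OF x]] by simp
  then show ?thesis
    using mono[OF x a(1,3)] mono[OF I.neg_in[OF x] a(1,4)] le[OF a(1,2)] a(5) by simp
qed

lemma rank_one_in_pair_pos_ops:
  assumes f: "positive_functional f" and z: "z \<in> carrier X" "\<zero> \<preceq> z"
    and Y: "z \<in> carrier Y \<or> (\<forall>y\<in>carrier Y. f y = 0)"
  shows "(\<lambda>s. f s \<odot> z) \<in> pair_pos_ops U X Y"
proof -
  let ?T = "\<lambda>s. f s \<odot> z"
  note zU = X.in_carrier[OF z(1)]
  have add: "?T (x \<oplus> y) = ?T x \<oplus> ?T y" if "x \<in> S" "y \<in> S" for x y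
    using positive_functionalD[OF f] that zU X.smult_l_distr[of "f x" "f y" z] by simp
  have scale: "?T (a \<odot> x) = a \<odot> ?T x" if "x \<in> S" for a x
    using positive_functionalD[OF f] that zU X.smult_assoc1[of a "f x" z] by simp
  have pos: "\<zero> \<preceq> ?T x" if "x \<in> S" "\<zero> \<preceq> x" for x
    using positive_functionalD[OF f] that zU z X.smult_nonneg by simp
  have TX: "?T x \<in> carrier X" for x using X.smult_in z by simp
  have TY: "?T y \<in> carrier Y" if "y \<in> carrier Y" for y
    using Y Y.smult_in that zU X.smult_l_null[of z] by auto
  have "linear_op (pair_sum U X Y) ?T"
    using add scale X_in_S[OF TX] by (auto simp: linear_op_def hom_def)
  moreover have "?T \<in> pos_ops X"
    unfolding pos_ops_def linear_op_def hom_def pos_cone_def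
    using add scale pos X_in_S TX by (auto simp: X.op_eqs)
  moreover have "?T \<in> pos_ops Y"
    unfolding pos_ops_def linear_op_def hom_def pos_cone_def
    using add scale pos Y_in_S TY by (auto simp: Y.op_eqs)
  ultimately show ?thesis by (simp add: pair_pos_ops_def)
qed

lemma op_norm_rank_one_le:
  assumes "banach_ideal U I" "carrier I \<subseteq> S" "z \<in> carrier I" "positive_functional f" "0 \<le> C"
    and "\<And>x. \<lbrakk>x \<in> carrier I; \<zero> \<preceq> x\<rbrakk> \<Longrightarrow> f x \<le> C * \<parallel>x\<parallel>\<^bsub>I\<^esub>"
  shows "op_norm I (\<lambda>s. f s \<odot> z) \<le> ennreal (C * \<parallel>z\<parallel>\<^bsub>I\<^esub>)"
  unfolding op_norm_def
proof (rule SUP_least)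
  interpret I: banach_ideal U I by fact
  fix x assume "x \<in> {x \<in> carrier I. \<parallel>x\<parallel>\<^bsub>I\<^esub> \<le> 1}"
  then have x: "x \<in> carrier I" "\<parallel>x\<parallel>\<^bsub>I\<^esub> \<le> 1" by auto
  have "\<bar>f x\<bar> \<le> C * \<parallel>x\<parallel>\<^bsub>I\<^esub>" by (rule positive_functional_bound) (use assms x in auto)
  also have "\<dots> \<le> C" using mult_left_mono[OF x(2) assms(5)] by simp
  finally have "\<parallel>f x \<odot> z\<parallel>\<^bsub>I\<^esub> \<le> C * \<parallel>z\<parallel>\<^bsub>I\<^esub>"
    using I.norm_scale[OF assms(3)] I.I.norm_nonneg[OF assms(3)] by (simp add: mult_right_mono)
  then show "ennreal (\<parallel>f x \<odot> z\<parallel>\<^bsub>I\<^esub>) \<le> ennreal (C * \<parallel>z\<parallel>\<^bsub>I\<^esub>)" by (rule ennreal_leI)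
qed

end

section \<open>A space of the first pair inside one of the second\<close>

context ideal_pair
begin

lemma P_Int_constD:
  assumes "Z \<in> P_Int_const c U X Y"
  shows "banach_ideal U Z" "carrier Z \<subseteq> S" "carrier X \<inter> carrier Y \<subseteq> carrier Z" "dominated U X Y Z"
    "\<And>T z. \<lbrakk>T \<in> pair_pos_ops U X Y; z \<in> carrier Z\<rbrakk> \<Longrightarrow> T z \<in> carrier Z"
    "\<And>T. T \<in> pair_pos_ops U X Y \<Longrightarrow> op_norm Z T \<le> ennreal c * max (op_norm X T) (op_norm Y T)"
proof -
  have i: "intermediate U X Y Z" using assms by (simp add: P_Int_const_def)
  show b: "banach_ideal U Z" by (rule intermediate_ideal[OF i])
  show "carrier Z \<subseteq> S" "carrier X \<inter> carrier Y \<subseteq> carrier Z" "dominated U X Y Z"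
    using i intermediate_iff[OF b] intermediate_dominated[OF i] by simp_all
qed (use assms in \<open>auto simp: P_Int_const_def\<close>)

text \<open>
  An element of \<open>Z\<close> at positive distance from \<open>Y\<close> is separated from \<open>Y\<close> by a positive functional
  \<open>f\<close> that vanishes on \<open>Y\<close>.  Then \<open>f \<otimes> z\<close> acts on both spaces of the pair for every \<open>z\<close> in
  \<open>X\<close>, and maps \<open>Z\<close> onto the multiples of \<open>z\<close>.
\<close>

lemma subset_if_gauge_0_pos:
  assumes Z: "Z \<in> P_Int_const c U X Y"
    and v: "v \<in> carrier Z" "0 < gauge 0 v"
  shows "carrier X \<subseteq> carrier Z"
proof (rule X.subset_if_positive_subset[OF P_Int_constD(1)[OF Z]])
  interpret Z: banach_ideal U Z by (rule P_Int_constD(1)[OF Z])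
  fix z assume z: "z \<in> carrier X" "\<zero> \<preceq> z"
  have "v \<in> S" using v P_Int_constD(2)[OF Z] by blast
  then obtain f where f: "positive_functional f" "f v = gauge 0 v"
    "\<And>y. \<lbrakk>y \<in> carrier Y; \<zero> \<preceq> y\<rbrakk> \<Longrightarrow> f y \<le> 0 * \<parallel>y\<parallel>\<^bsub>Y\<^esub>"
    by (rule ex_positive_functional[where \<epsilon> = 0]) auto
  have "carrier Y \<subseteq> S" using Y_in_S by blast
  then have "f y = 0" if "y \<in> carrier Y" for y
    using positive_functional_bound[OF f(1) Y.banach_ideal_axioms _ f(3) that] by simp
  then have "(\<lambda>s. f s \<odot> z) \<in> pair_pos_ops U X Y"
    using rank_one_in_pair_pos_ops[OF f(1) z] by blast
  then have "f v \<odot> z \<in> carrier Z" using P_Int_constD(5)[OF Z _ v(1)] by blast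
  then have "(1 / f v) \<odot> (f v \<odot> z) \<in> carrier Z" by (rule Z.smult_in)
  moreover have "(1 / f v) \<odot> (f v \<odot> z) = z"
    using X.smult_assoc1[of "1 / f v" "f v" z] X.in_carrier[OF z(1)] v(2) f(2) by simp
  ultimately show "z \<in> carrier Z" by simp
qed

text \<open>
  A functional \<open>f\<close> below \<open>gauge \<epsilon>\<close> that attains the gauge at the given \<open>v\<close> yields an operator
  \<open>f \<otimes> z\<close> of norm at most \<open>\<parallel>z\<parallel>\<^bsub>X\<^esub>\<close> on \<open>X\<close>, at most \<open>\<epsilon> \<parallel>z\<parallel>\<^bsub>Y\<^esub>\<close> on \<open>Y\<close> and at
  least \<open>\<delta> \<parallel>z\<parallel>\<^bsub>Z\<^esub>\<close> on \<open>Z\<close>.  For small \<open>\<epsilon>\<close> the bound for \<open>Y\<close> is dominated by the one for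
  \<open>X\<close>.
\<close>

lemma norm_le_if_gauges_large:
  assumes Z: "Z \<in> P_Int_const c U X Y" and c: "0 \<le> c"
    and large: "\<And>\<epsilon>. 0 < \<epsilon> \<Longrightarrow> \<exists>v\<in>carrier Z. \<zero> \<preceq> v \<and> \<delta> * \<parallel>v\<parallel>\<^bsub>Z\<^esub> < gauge \<epsilon> v"
    and z: "z \<in> carrier X" "z \<in> carrier Y" "\<zero> \<preceq> z"
  shows "\<delta> * \<parallel>z\<parallel>\<^bsub>Z\<^esub> \<le> c * \<parallel>z\<parallel>\<^bsub>X\<^esub>"
proof (cases "z = \<zero>")
  case True
  interpret Z: banach_ideal U Z by (rule P_Int_constD(1)[OF Z])
  show ?thesis by (simp add: True)
next
  case False
  interpret Z: banach_ideal U Z by (rule P_Int_constD(1)[OF Z])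
  have zZ: "z \<in> carrier Z" using z P_Int_constD(3)[OF Z] by blast
  have pos: "0 < \<parallel>z\<parallel>\<^bsub>X\<^esub>" "0 < \<parallel>z\<parallel>\<^bsub>Y\<^esub>"
    using False X.norm_0_iff[OF z(1)] X.I.norm_nonneg[OF z(1)] Y.norm_0_iff[OF z(2)]
      Y.I.norm_nonneg[OF z(2)] by linarith+
  \<comment> \<open>the largest \<open>\<epsilon>\<close> for which the bound on \<open>Y\<close> does not exceed the one on \<open>X\<close>\<close>
  define \<epsilon> where "\<epsilon> = \<parallel>z\<parallel>\<^bsub>X\<^esub> / \<parallel>z\<parallel>\<^bsub>Y\<^esub>"
  have e: "0 < \<epsilon>" "\<epsilon> * \<parallel>z\<parallel>\<^bsub>Y\<^esub> = \<parallel>z\<parallel>\<^bsub>X\<^esub>" using pos by (simp_all add: \<epsilon>_def)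
  obtain v where v: "v \<in> carrier Z" "\<zero> \<preceq> v" "\<delta> * \<parallel>v\<parallel>\<^bsub>Z\<^esub> < gauge \<epsilon> v" using large[OF e(1)] by blast
  have "v \<noteq> \<zero>" using v(3) gauge_nonpos[of \<zero> \<epsilon>] e by auto
  then have n: "0 < \<parallel>v\<parallel>\<^bsub>Z\<^esub>" using Z.norm_0_iff[OF v(1)] Z.I.norm_nonneg[OF v(1)] by linarith
  have vS: "v \<in> S" using v P_Int_constD(2)[OF Z] by blast
  obtain f where f: "positive_functional f" "f v = gauge \<epsilon> v"
    "\<And>x. \<lbrakk>x \<in> carrier X; \<zero> \<preceq> x\<rbrakk> \<Longrightarrow> f x \<le> \<parallel>x\<parallel>\<^bsub>X\<^esub>"
    "\<And>y. \<lbrakk>y \<in> carrier Y; \<zero> \<preceq> y\<rbrakk> \<Longrightarrow> f y \<le> \<epsilon> * \<parallel>y\<parallel>\<^bsub>Y\<^esub>"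
    by (rule ex_positive_functional[OF vS, of \<epsilon>]) (use e in auto)
  let ?T = "\<lambda>s. f s \<odot> z"
  define u where "u = (1 / \<parallel>v\<parallel>\<^bsub>Z\<^esub>) \<odot> v"
  have u: "u \<in> carrier Z" "\<parallel>u\<parallel>\<^bsub>Z\<^esub> \<le> 1" "\<delta> < f u"
    using Z.smult_in v(1,3) Z.norm_scale[OF v(1)] n positive_functionalD(2)[OF f(1) vS] f(2)
    by (simp_all add: u_def pos_less_divide_eq)
  have "ennreal (\<parallel>?T u\<parallel>\<^bsub>Z\<^esub>) \<le> op_norm Z ?T"
    unfolding op_norm_def by (rule SUP_upper) (use u in simp)
  also have "op_norm Z ?T \<le> ennreal c * max (op_norm X ?T) (op_norm Y ?T)"
    using P_Int_constD(6)[OF Z] rank_one_in_pair_pos_ops[OF f(1) z(1,3)] z(2) by blast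
  also have "\<dots> \<le> ennreal c * ennreal (\<parallel>z\<parallel>\<^bsub>X\<^esub>)"
  proof (rule mult_left_mono)
    have "op_norm X ?T \<le> ennreal (1 * \<parallel>z\<parallel>\<^bsub>X\<^esub>)"
      by (rule op_norm_rank_one_le) (use X.banach_ideal_axioms X_in_S z f in auto)
    moreover have "op_norm Y ?T \<le> ennreal (\<epsilon> * \<parallel>z\<parallel>\<^bsub>Y\<^esub>)"
      by (rule op_norm_rank_one_le) (use Y.banach_ideal_axioms Y_in_S z f e in auto)
    ultimately show "max (op_norm X ?T) (op_norm Y ?T) \<le> ennreal (\<parallel>z\<parallel>\<^bsub>X\<^esub>)"
      using e(2) by simp
  qed simp
  also have "\<dots> = ennreal (c * \<parallel>z\<parallel>\<^bsub>X\<^esub>)" using c pos by (simp add: ennreal_mult)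
  finally have "\<parallel>?T u\<parallel>\<^bsub>Z\<^esub> \<le> c * \<parallel>z\<parallel>\<^bsub>X\<^esub>" using c pos by (simp add: ennreal_le_iff)
  then have "\<bar>f u\<bar> * \<parallel>z\<parallel>\<^bsub>Z\<^esub> \<le> c * \<parallel>z\<parallel>\<^bsub>X\<^esub>" using Z.norm_scale[OF zZ] by simp
  moreover have "\<delta> * \<parallel>z\<parallel>\<^bsub>Z\<^esub> \<le> \<bar>f u\<bar> * \<parallel>z\<parallel>\<^bsub>Z\<^esub>"
    using u(3) Z.I.norm_nonneg[OF zZ] by (intro mult_right_mono) auto
  ultimately show ?thesis by linarith
qed

text \<open>
  When \<open>gauge 0\<close> vanishes on \<open>X\<close>, the intersection \<open>X \<inter> Y\<close> is dense in \<open>X\<close>: half of an element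
  of \<open>X\<close> can always be removed inside the intersection, where the norm of \<open>Z\<close> is controlled by
  that of \<open>X\<close>.
\<close>

lemma subset_if_gauges_large:
  assumes Z: "Z \<in> P_Int_const c U X Y" and c: "0 \<le> c" and d: "0 < \<delta>"
    and large: "\<And>\<epsilon>. 0 < \<epsilon> \<Longrightarrow> \<exists>v\<in>carrier Z. \<zero> \<preceq> v \<and> \<delta> * \<parallel>v\<parallel>\<^bsub>Z\<^esub> < gauge \<epsilon> v"
    and dense: "\<And>x. \<lbrakk>x \<in> carrier X; \<zero> \<preceq> x\<rbrakk> \<Longrightarrow> gauge 0 x \<le> 0"
  shows "carrier X \<subseteq> carrier Z"
proof (rule subset_by_halving[OF X.banach_ideal_axioms P_Int_constD(1)[OF Z], of "c / \<delta>"])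
  interpret Z: banach_ideal U Z by (rule P_Int_constD(1)[OF Z])
  fix x assume x: "x \<in> carrier X" "\<zero> \<preceq> x"
  show "\<exists>x'\<in>carrier X. \<exists>b\<in>carrier Z. \<zero> \<preceq> x' \<and> \<zero> \<preceq> b \<and> x \<preceq> x' \<oplus> b \<and>
      \<parallel>x'\<parallel>\<^bsub>X\<^esub> \<le> \<parallel>x\<parallel>\<^bsub>X\<^esub> / 2 \<and> \<parallel>b\<parallel>\<^bsub>Z\<^esub> \<le> c / \<delta> * \<parallel>x\<parallel>\<^bsub>X\<^esub>"
  proof (cases "x = \<zero>")
    case True
    then show ?thesis by (intro bexI[of _ \<zero>]) auto
  next
    case False
    then have "0 < \<parallel>x\<parallel>\<^bsub>X\<^esub>" using X.norm_0_iff[OF x(1)] X.I.norm_nonneg[OF x(1)] by linarith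
    then have "gauge 0 x < \<parallel>x\<parallel>\<^bsub>X\<^esub> / 2" using dense[OF x] by linarith
    then obtain a y where ay: "a \<in> carrier X" "y \<in> carrier Y" "\<zero> \<preceq> a" "\<zero> \<preceq> y" "x \<preceq> a \<oplus> y"
      "\<parallel>a\<parallel>\<^bsub>X\<^esub> + 0 * \<parallel>y\<parallel>\<^bsub>Y\<^esub> < \<parallel>x\<parallel>\<^bsub>X\<^esub> / 2"
      by (rule gauge_less[OF X_in_S[OF x(1)]])
    obtain a' y' where d': "a' \<in> carrier U" "y' \<in> carrier U" "\<zero> \<preceq> a'" "\<zero> \<preceq> y'"
      "a' \<preceq> a" "y' \<preceq> y" "a' \<preceq> x" "y' \<preceq> x" "x \<preceq> a' \<oplus> y'"
      by (rule X.riesz_decomposition[OF X.in_carrier[OF x(1)] X.in_carrier[OF ay(1)]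
            Y.in_carrier[OF ay(2)] x(2) ay(3,4,5)])
    have a': "a' \<in> carrier X" using X.solid[OF ay(1) d'(1,3,5)] .
    have y': "y' \<in> carrier X" "y' \<in> carrier Y"
      using X.solid[OF x(1) d'(2,4,8)] Y.solid[OF ay(2) d'(2,4,6)] .
    have "\<delta> * \<parallel>y'\<parallel>\<^bsub>Z\<^esub> \<le> c * \<parallel>y'\<parallel>\<^bsub>X\<^esub>" by (rule norm_le_if_gauges_large[OF Z c large y' d'(4)])
    also have "\<dots> \<le> c * \<parallel>x\<parallel>\<^bsub>X\<^esub>"
      using X.norm_positive_mono[OF y'(1) x(1) d'(4,8)] c by (rule mult_left_mono)
    finally have "\<parallel>y'\<parallel>\<^bsub>Z\<^esub> \<le> c / \<delta> * \<parallel>x\<parallel>\<^bsub>X\<^esub>" using d by (simp add: field_simps)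
    moreover have "\<parallel>a'\<parallel>\<^bsub>X\<^esub> \<le> \<parallel>x\<parallel>\<^bsub>X\<^esub> / 2"
      using X.norm_positive_mono[OF a' ay(1) d'(3,5)] ay(6) by linarith
    moreover have "y' \<in> carrier Z" using y' P_Int_constD(3)[OF Z] by blast
    ultimately show ?thesis using a' d' by blast
  qed
qed (use c d in simp)

text \<open>
  Unless \<open>subset_if_gauge_0_pos\<close> or \<open>subset_if_gauges_large\<close> applies to \<open>V\<close> or to \<open>W\<close>, some \<open>gauge \<epsilon>\<close> is small on
  both, hence on \<open>X\<close>, whose elements split between \<open>V\<close> and \<open>W\<close>.  So elements of \<open>X\<close> can be halved by removing
  elements of \<open>Y\<close> of comparable norm, which gives \<open>X \<subseteq> Y\<close>.
\<close>

lemma subset_dichotomy: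
  assumes V: "V \<in> P_Int_const c U X Y" "0 \<le> c" and W: "W \<in> P_Int_const c' U X Y" "0 \<le> c'"
    and dom: "dominated U V W X"
  shows "carrier X \<subseteq> carrier Y \<or> carrier X \<subseteq> carrier V \<or> carrier X \<subseteq> carrier W"
proof -
  interpret V: banach_ideal U V by (rule P_Int_constD(1)[OF V(1)])
  interpret W: banach_ideal U W by (rule P_Int_constD(1)[OF W(1)])
  have S: "v \<in> S" if "v \<in> carrier V \<or> v \<in> carrier W" for v
    using that P_Int_constD(2)[OF V(1)] P_Int_constD(2)[OF W(1)] by blast
  obtain K where K0: "0 < K" "\<And>x. x \<in> pos_cone U \<inter> carrier X \<Longrightarrow> \<exists>v\<in>pos_cone U \<inter> carrier V.
      \<exists>w\<in>pos_cone U \<inter> carrier W. x \<preceq> v \<oplus> w \<and> \<parallel>v\<parallel>\<^bsub>V\<^esub> + \<parallel>w\<parallel>\<^bsub>W\<^esub> \<le> K * \<parallel>x\<parallel>\<^bsub>X\<^esub>"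
    using dom unfolding dominated_def by blast
  have K: "0 < K" "\<And>x. \<lbrakk>x \<in> carrier X; \<zero> \<preceq> x\<rbrakk> \<Longrightarrow> \<exists>v\<in>carrier V. \<exists>w\<in>carrier W.
      \<zero> \<preceq> v \<and> \<zero> \<preceq> w \<and> x \<preceq> v \<oplus> w \<and> \<parallel>v\<parallel>\<^bsub>V\<^esub> + \<parallel>w\<parallel>\<^bsub>W\<^esub> \<le> K * \<parallel>x\<parallel>\<^bsub>X\<^esub>"
    using K0 X.in_carrier unfolding pos_cone_def by blast+
  show ?thesis
  proof (cases "\<exists>x\<in>carrier X. \<zero> \<preceq> x \<and> 0 < gauge 0 x")
    case True
    then obtain x where x: "x \<in> carrier X" "\<zero> \<preceq> x" "0 < gauge 0 x" by blast
    obtain v w where vw: "v \<in> carrier V" "w \<in> carrier W" "x \<preceq> v \<oplus> w" using K(2)[OF x(1,2)] by blast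
    have "gauge 0 x \<le> gauge 0 v + gauge 0 w"
      using gauge_add_le[of x v w 0] vw X.in_carrier[OF x(1)] S by simp
    then have "0 < gauge 0 v \<or> 0 < gauge 0 w" using x(3) by linarith
    then show ?thesis
      using subset_if_gauge_0_pos[OF V(1) vw(1)] subset_if_gauge_0_pos[OF W(1) vw(2)] by blast
  next
    case False
    then have dense: "gauge 0 x \<le> 0" if "x \<in> carrier X" "\<zero> \<preceq> x" for x using that by force
    \<comment> \<open>small enough that \<open>gauge \<epsilon> \<le> \<delta> \<parallel>\<cdot>\<parallel>\<close> on \<open>V\<close> and \<open>W\<close> gives \<open>gauge \<epsilon> x < \<parallel>x\<parallel> / 2\<close> on \<open>X\<close>\<close>
    define \<delta> where "\<delta> = 1 / (4 * K)"
    have d: "0 < \<delta>" "\<delta> * K = 1 / 4" using K(1) by (simp_all add: \<delta>_def)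
    let ?large = "\<lambda>Z \<epsilon>. \<exists>v\<in>carrier Z. \<zero> \<preceq> v \<and> \<delta> * \<parallel>v\<parallel>\<^bsub>Z\<^esub> < gauge \<epsilon> v"
    have mono: "?large Z \<epsilon>'" if "?large Z \<epsilon>" "0 < \<epsilon>" "\<epsilon> \<le> \<epsilon>'" "Z = V \<or> Z = W" for Z :: "'a blat" and \<epsilon> \<epsilon>'
    proof -
      obtain v where v: "v \<in> carrier Z" "\<zero> \<preceq> v" "\<delta> * \<parallel>v\<parallel>\<^bsub>Z\<^esub> < gauge \<epsilon> v" using \<open>?large Z \<epsilon>\<close> by blast
      then have "gauge \<epsilon> v \<le> gauge \<epsilon>' v" using that S by (intro gauge_mono_eps) auto
      then show ?thesis using v by (intro bexI[of _ v]) auto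
    qed
    show ?thesis
    proof (cases "\<forall>\<epsilon>>0. ?large V \<epsilon> \<or> ?large W \<epsilon>")
      case True
      have "(\<forall>\<epsilon>>0. ?large V \<epsilon>) \<or> (\<forall>\<epsilon>>0. ?large W \<epsilon>)"
      proof (rule ccontr)
        assume "\<not> ?thesis"
        then obtain e e' where e: "0 < e" "\<not> ?large V e" "0 < e'" "\<not> ?large W e'" by blast
        then have "0 < min e e'" by simp
        then have "?large V (min e e') \<or> ?large W (min e e')" using True by blast
        moreover have "\<not> ?large V (min e e')" using mono[OF _ \<open>0 < min e e'\<close>, of V e] e(2) by auto
        moreover have "\<not> ?large W (min e e')" using mono[OF _ \<open>0 < min e e'\<close>, of W e'] e(4) by auto
        ultimately show False by blast
      qed
      then show ?thesis
        using subset_if_gauges_large[OF V d(1) _ dense] subset_if_gauges_large[OF W d(1) _ dense] by blast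
    next
      case False
      then obtain \<epsilon> where e: "0 < \<epsilon>" and small:
        "\<And>v. \<lbrakk>v \<in> carrier V; \<zero> \<preceq> v\<rbrakk> \<Longrightarrow> gauge \<epsilon> v \<le> \<delta> * \<parallel>v\<parallel>\<^bsub>V\<^esub>"
        "\<And>w. \<lbrakk>w \<in> carrier W; \<zero> \<preceq> w\<rbrakk> \<Longrightarrow> gauge \<epsilon> w \<le> \<delta> * \<parallel>w\<parallel>\<^bsub>W\<^esub>"
        by (auto simp: not_less)
      have "carrier X \<subseteq> carrier Y"
      proof (rule subset_by_halving[OF X.banach_ideal_axioms Y.banach_ideal_axioms, of "1 / (2 * \<epsilon>)"])
        fix x assume x: "x \<in> carrier X" "\<zero> \<preceq> x"
        show "\<exists>x'\<in>carrier X. \<exists>b\<in>carrier Y. \<zero> \<preceq> x' \<and> \<zero> \<preceq> b \<and> x \<preceq> x' \<oplus> b \<and>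
          \<parallel>x'\<parallel>\<^bsub>X\<^esub> \<le> \<parallel>x\<parallel>\<^bsub>X\<^esub> / 2 \<and> \<parallel>b\<parallel>\<^bsub>Y\<^esub> \<le> 1 / (2 * \<epsilon>) * \<parallel>x\<parallel>\<^bsub>X\<^esub>"
        proof (cases "x = \<zero>")
          case True
          then show ?thesis by (intro bexI[of _ \<zero>]) auto
        next
          case False
          then have pos: "0 < \<parallel>x\<parallel>\<^bsub>X\<^esub>" using X.norm_0_iff[OF x(1)] X.I.norm_nonneg[OF x(1)] by linarith
          obtain v w where vw: "v \<in> carrier V" "w \<in> carrier W" "\<zero> \<preceq> v" "\<zero> \<preceq> w" "x \<preceq> v \<oplus> w"
            and le: "\<parallel>v\<parallel>\<^bsub>V\<^esub> + \<parallel>w\<parallel>\<^bsub>W\<^esub> \<le> K * \<parallel>x\<parallel>\<^bsub>X\<^esub>" using K(2)[OF x] by blast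
          have "gauge \<epsilon> x \<le> gauge \<epsilon> v + gauge \<epsilon> w"
            using gauge_add_le[of x v w \<epsilon>] vw X.in_carrier[OF x(1)] S e by simp
          also have "\<dots> \<le> \<delta> * (\<parallel>v\<parallel>\<^bsub>V\<^esub> + \<parallel>w\<parallel>\<^bsub>W\<^esub>)"
            using small(1)[OF vw(1,3)] small(2)[OF vw(2,4)] by (simp add: distrib_left)
          also have "\<dots> \<le> \<delta> * (K * \<parallel>x\<parallel>\<^bsub>X\<^esub>)" using le d(1) by (intro mult_left_mono) auto
          also have "\<dots> = \<parallel>x\<parallel>\<^bsub>X\<^esub> / 4" using d(2) by (simp flip: mult.assoc)
          also have "\<dots> < \<parallel>x\<parallel>\<^bsub>X\<^esub> / 2" using pos by simp
          finally have "gauge \<epsilon> x < \<parallel>x\<parallel>\<^bsub>X\<^esub> / 2" .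
          then obtain a y where ay: "a \<in> carrier X" "y \<in> carrier Y" "\<zero> \<preceq> a" "\<zero> \<preceq> y" "x \<preceq> a \<oplus> y"
            "\<parallel>a\<parallel>\<^bsub>X\<^esub> + \<epsilon> * \<parallel>y\<parallel>\<^bsub>Y\<^esub> < \<parallel>x\<parallel>\<^bsub>X\<^esub> / 2"
            by (rule gauge_less[OF X_in_S[OF x(1)]])
          have n: "0 \<le> \<parallel>a\<parallel>\<^bsub>X\<^esub>" "0 \<le> \<epsilon> * \<parallel>y\<parallel>\<^bsub>Y\<^esub>"
            using X.I.norm_nonneg[OF ay(1)] Y.I.norm_nonneg[OF ay(2)] e by simp_all
          have "\<parallel>y\<parallel>\<^bsub>Y\<^esub> \<le> 1 / (2 * \<epsilon>) * \<parallel>x\<parallel>\<^bsub>X\<^esub>"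
            using ay(6) n(1) e by (simp add: field_simps)
          moreover have "\<parallel>a\<parallel>\<^bsub>X\<^esub> \<le> \<parallel>x\<parallel>\<^bsub>X\<^esub> / 2" using ay(6) n(2) by linarith
          ultimately show ?thesis using ay by blast
        qed
      qed (use e in simp)
      then show ?thesis by blast
    qed
  qed
qed

text \<open>
  The modular law for ideals: an element of \<open>V\<close> splits into parts in \<open>X\<close> and in \<open>Y\<close> below it,
  and the second part lies in \<open>V \<inter> W\<close>.
\<close>

lemma subset_by_modularity:
  assumes "banach_ideal U V" "dominated U X Y V"
    and Y: "carrier Y \<subseteq> carrier W" and VW: "carrier V \<inter> carrier W \<subseteq> carrier X"
  shows "carrier V \<subseteq> carrier X"
proof -
  interpret V: banach_ideal U V by fact
  show ?thesis
  proof (rule V.subset_if_positive_subset[OF X.banach_ideal_axioms])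
    fix v assume v: "v \<in> carrier V" "\<zero> \<preceq> v"
    then obtain x y where xy: "x \<in> carrier X" "y \<in> carrier Y" "\<zero> \<preceq> x" "\<zero> \<preceq> y" "v \<preceq> x \<oplus> y"
      using assms(2) V.in_carrier[OF v(1)] unfolding dominated_def pos_cone_def by blast
    note c = V.in_carrier[OF v(1)] X.in_carrier[OF xy(1)] Y.in_carrier[OF xy(2)]
    obtain x' y' where d: "x' \<in> carrier U" "y' \<in> carrier U" "\<zero> \<preceq> x'" "\<zero> \<preceq> y'"
      "x' \<preceq> x" "y' \<preceq> y" "x' \<preceq> v" "y' \<preceq> v" "v \<preceq> x' \<oplus> y'"
      by (rule X.riesz_decomposition[OF c v(2) xy(3,4,5)])
    have "y' \<in> carrier V" "y' \<in> carrier Y"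
      using V.solid[OF v(1) d(2,4,8)] Y.solid[OF xy(2) d(2,4,6)] .
    then have "y' \<in> carrier X" using Y VW by blast
    moreover have "x' \<in> carrier X" using X.solid[OF xy(1) d(1,3,5)] .
    ultimately show "v \<in> carrier X" using X.solid[OF X.add_in[of x' y'] c(1) v(2) d(9)] by blast
  qed
qed

end

section \<open>Two pairs with the same interpolation spaces\<close>

text \<open>
  The two ambient lattices may disagree about the sum of an element of \<open>V\<close> and one of \<open>W\<close>.  By
  Riesz decomposition the summands can be cut down to elements of \<open>X\<close>, where the additions agree.
\<close>

lemma dominated_transfer:
  fixes U U' :: "'a vlat"
  assumes U: "banach_ideal U V" "banach_ideal U W" "banach_ideal U X"
    and U': "banach_ideal U' V" "banach_ideal U' W" "banach_ideal U' X"
    and dom: "dominated U' V W X"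
  shows "dominated U V W X"
proof -
  interpret V: banach_ideal U V by fact
  interpret W: banach_ideal U W by fact
  interpret X: banach_ideal U X by fact
  interpret V': banach_ideal U' V by fact
  interpret W': banach_ideal U' W by fact
  interpret X': banach_ideal U' X by fact
  obtain K where K: "0 < K" "\<And>x. x \<in> pos_cone U' \<inter> carrier X \<Longrightarrow> \<exists>v\<in>pos_cone U' \<inter> carrier V.
      \<exists>w\<in>pos_cone U' \<inter> carrier W. x \<preceq>\<^bsub>U'\<^esub> v \<oplus>\<^bsub>U'\<^esub> w \<and> \<parallel>v\<parallel>\<^bsub>V\<^esub> + \<parallel>w\<parallel>\<^bsub>W\<^esub> \<le> K * \<parallel>x\<parallel>\<^bsub>X\<^esub>"
    using dom unfolding dominated_def by blast
  have zero: "\<zero>\<^bsub>U'\<^esub> = \<zero>\<^bsub>U\<^esub>" using X.op_eqs(1) X'.op_eqs(1) by simp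
  have "\<exists>v\<in>pos_cone U \<inter> carrier V. \<exists>w\<in>pos_cone U \<inter> carrier W.
      x \<preceq>\<^bsub>U\<^esub> v \<oplus>\<^bsub>U\<^esub> w \<and> \<parallel>v\<parallel>\<^bsub>V\<^esub> + \<parallel>w\<parallel>\<^bsub>W\<^esub> \<le> K * \<parallel>x\<parallel>\<^bsub>X\<^esub>" if x: "x \<in> pos_cone U \<inter> carrier X" for x
  proof -
    have xX: "x \<in> carrier X" using x by simp
    have pos: "\<zero>\<^bsub>U\<^esub> \<preceq>\<^bsub>U\<^esub> z \<longleftrightarrow> \<zero>\<^bsub>U'\<^esub> \<preceq>\<^bsub>U'\<^esub> z" if "z \<in> carrier X" for z
      using X.op_eqs(4)[OF X.zero_in that] X'.op_eqs(4)[OF X'.zero_in that] zero by simp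
    have x0: "\<zero>\<^bsub>U'\<^esub> \<preceq>\<^bsub>U'\<^esub> x" using x pos[OF xX] by (simp add: pos_cone_def)
    then obtain v w where vw: "v \<in> carrier V" "w \<in> carrier W" "\<zero>\<^bsub>U'\<^esub> \<preceq>\<^bsub>U'\<^esub> v" "\<zero>\<^bsub>U'\<^esub> \<preceq>\<^bsub>U'\<^esub> w"
      "x \<preceq>\<^bsub>U'\<^esub> v \<oplus>\<^bsub>U'\<^esub> w" and le: "\<parallel>v\<parallel>\<^bsub>V\<^esub> + \<parallel>w\<parallel>\<^bsub>W\<^esub> \<le> K * \<parallel>x\<parallel>\<^bsub>X\<^esub>"
      using K(2)[of x] xX X'.in_carrier[OF xX] by (auto simp: pos_cone_def)
    obtain v' w' where d: "v' \<in> carrier U'" "w' \<in> carrier U'" "\<zero>\<^bsub>U'\<^esub> \<preceq>\<^bsub>U'\<^esub> v'" "\<zero>\<^bsub>U'\<^esub> \<preceq>\<^bsub>U'\<^esub> w'"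
      "v' \<preceq>\<^bsub>U'\<^esub> v" "w' \<preceq>\<^bsub>U'\<^esub> w" "v' \<preceq>\<^bsub>U'\<^esub> x" "w' \<preceq>\<^bsub>U'\<^esub> x" "x \<preceq>\<^bsub>U'\<^esub> v' \<oplus>\<^bsub>U'\<^esub> w'"
      by (rule V'.riesz_decomposition[OF X'.in_carrier[OF xX] V'.in_carrier[OF vw(1)]
            W'.in_carrier[OF vw(2)] x0 vw(3,4,5)])
    have inX: "v' \<in> carrier X" "w' \<in> carrier X"
      using X'.solid[OF xX d(1,3,7)] X'.solid[OF xX d(2,4,8)] .
    have inVW: "v' \<in> carrier V" "w' \<in> carrier W"
      using V'.solid[OF vw(1) d(1,3,5)] W'.solid[OF vw(2) d(2,4,6)] .
    have "x \<preceq>\<^bsub>X\<^esub> v' \<oplus>\<^bsub>X\<^esub> w'"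
      using d(9) X'.op_eqs(2)[OF inX] X'.op_eqs(4)[OF xX X'.add_in[OF inX]] by simp
    then have "x \<preceq>\<^bsub>U\<^esub> v' \<oplus>\<^bsub>U\<^esub> w'"
      using X.op_eqs(2)[OF inX] X.op_eqs(4)[OF xX X.add_in[OF inX]] by simp
    moreover have "\<parallel>v'\<parallel>\<^bsub>V\<^esub> + \<parallel>w'\<parallel>\<^bsub>W\<^esub> \<le> K * \<parallel>x\<parallel>\<^bsub>X\<^esub>"
      using V'.norm_positive_mono[OF inVW(1) vw(1) d(3,5)] W'.norm_positive_mono[OF inVW(2) vw(2) d(4,6)] le
      by linarith
    ultimately show ?thesis
      using inVW inX d(3,4) pos X.in_carrier by (intro bexI[of _ v'] bexI[of _ w']) (auto simp: pos_cone_def)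
  qed
  then show ?thesis using K(1) unfolding dominated_def by blast
qed

lemma ideal_pair_of_interpolation_pair: "interpolation_pair U X Y \<Longrightarrow> ideal_pair U X Y"
  using interpolation_pair_ideals[of U X Y] by (simp add: ideal_pair_def)

lemma ideal_pair_swap: "ideal_pair U X Y \<Longrightarrow> ideal_pair U Y X"
  by (simp add: ideal_pair_def)

lemma shared_P_Int:
  assumes XY: "ideal_pair U X Y" and VW: "ideal_pair U' V W" and eq: "P_Int U X Y = P_Int U' V W"
  shows "carrier X \<subseteq> carrier Y \<or> carrier X \<subseteq> carrier V \<or> carrier X \<subseteq> carrier W"
    and "banach_ideal U V" and "carrier X \<inter> carrier Y \<subseteq> carrier V"
    and "\<lbrakk>carrier X \<subseteq> carrier V; carrier Y \<subseteq> carrier W\<rbrakk> \<Longrightarrow> carrier V = carrier X"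
proof -
  interpret XY: ideal_pair U X Y by fact
  interpret VW: ideal_pair U' V W by fact
  interpret YX: ideal_pair U Y X by (rule ideal_pair_swap) fact
  interpret WV: ideal_pair U' W V by (rule ideal_pair_swap) fact
  have "V \<in> P_Int U X Y" "W \<in> P_Int U X Y"
    using VW.left_in_P_Int WV.left_in_P_Int by (simp_all add: eq WV.P_Int_commute)
  then obtain c c' where V: "V \<in> P_Int_const c U X Y" "0 \<le> c" and W: "W \<in> P_Int_const c' U X Y" "0 \<le> c'"
    unfolding P_Int_def by force
  have "X \<in> P_Int U' V W" "Y \<in> P_Int U' V W"
    using XY.left_in_P_Int YX.left_in_P_Int by (simp_all flip: eq add: YX.P_Int_commute)
  then obtain k where X: "X \<in> P_Int_const k U' V W" unfolding P_Int_def by blast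
  note V' = XY.P_Int_constD[OF V(1)] and W' = XY.P_Int_constD[OF W(1)] and X' = VW.P_Int_constD[OF X]
  have "dominated U V W X"
    by (rule dominated_transfer[OF V'(1) W'(1) XY.X.banach_ideal_axioms VW.X.banach_ideal_axioms
          VW.Y.banach_ideal_axioms X'(1,4)])
  then show "carrier X \<subseteq> carrier Y \<or> carrier X \<subseteq> carrier V \<or> carrier X \<subseteq> carrier W"
    by (rule XY.subset_dichotomy[OF V W])
  show "banach_ideal U V" "carrier X \<inter> carrier Y \<subseteq> carrier V" by (fact V')+
  show "carrier V = carrier X" if "carrier X \<subseteq> carrier V" "carrier Y \<subseteq> carrier W"
    using XY.subset_by_modularity[OF V'(1,4) that(2) X'(3)] that(1) by blast
qed

lemma lattice_equiv_if_same_carrier: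
  assumes "banach_ideal U X" "banach_ideal U V" and eq: "carrier X = carrier V"
  shows "X \<simeq>\<^sub>L V"
proof -
  interpret X: banach_ideal U X by fact
  interpret V: banach_ideal U V by fact
  obtain K where K: "0 < K" "\<And>x. x \<in> carrier X \<Longrightarrow> \<parallel>x\<parallel>\<^bsub>V\<^esub> \<le> K * \<parallel>x\<parallel>\<^bsub>X\<^esub>"
    using inclusion_bounded[OF assms(1,2)] eq by blast
  obtain L where L: "0 < L" "\<And>x. x \<in> carrier V \<Longrightarrow> \<parallel>x\<parallel>\<^bsub>X\<^esub> \<le> L * \<parallel>x\<parallel>\<^bsub>V\<^esub>"
    using inclusion_bounded[OF assms(2,1)] eq by blast
  have "same_ops X V" using X.ops V.ops eq by (simp add: same_ops_def)
  moreover have "1 / L * \<parallel>x\<parallel>\<^bsub>X\<^esub> \<le> \<parallel>x\<parallel>\<^bsub>V\<^esub>" if "x \<in> carrier X" for x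
    using L that eq by (simp add: field_simps)
  ultimately show ?thesis
    unfolding lattice_equiv_def using K L(1) eq
    by (intro conjI exI[of _ "1 / L"] exI[of _ K]) auto
qed

theorem theorem1:
  fixes U U' :: "'a vlat" and X Y V W :: "'a blat"
  assumes "interpolation_pair U X Y"
    and "interpolation_pair U' V W"
    and "P_Int U X Y = P_Int U' V W"
  shows "(X \<simeq>\<^sub>L V \<and> Y \<simeq>\<^sub>L W) \<or> (X \<simeq>\<^sub>L W \<and> Y \<simeq>\<^sub>L V)"
proof -
  have XY: "ideal_pair U X Y" and VW: "ideal_pair U' V W"
    using assms by (auto intro: ideal_pair_of_interpolation_pair)
  note YX = ideal_pair_swap[OF XY] and WV = ideal_pair_swap[OF VW]
  have eq: "P_Int U X Y = P_Int U' V W" "P_Int U X Y = P_Int U' W V"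
      "P_Int U Y X = P_Int U' V W" "P_Int U Y X = P_Int U' W V"
    using assms(3) ideal_pair.P_Int_commute[OF XY] ideal_pair.P_Int_commute[OF VW] by simp_all
  have inter: "carrier X \<inter> carrier Y = carrier V \<inter> carrier W"
    using shared_P_Int(3)[OF XY VW eq(1)] shared_P_Int(3)[OF XY WV eq(2)]
      shared_P_Int(3)[OF VW XY eq(1)[symmetric]] shared_P_Int(3)[OF VW YX eq(3)[symmetric]] by blast
  \<comment> \<open>If \<open>X\<close> and \<open>Y\<close> are incomparable, they cannot both lie in \<open>V\<close>: this would leave no room for
    \<open>V\<close> inside \<open>W\<close>, \<open>X\<close> or \<open>Y\<close>; likewise for \<open>W\<close>.  If \<open>X \<subseteq> Y\<close>, then \<open>X\<close> is the common
    intersection and lies in both \<open>V\<close> and \<open>W\<close>, while \<open>Y\<close> lies in one of them unless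
    \<open>X = Y\<close>, when \<open>X\<close> and \<open>Y\<close> lie in both.\<close>
  have "(carrier X \<subseteq> carrier V \<and> carrier Y \<subseteq> carrier W) \<or> (carrier X \<subseteq> carrier W \<and> carrier Y \<subseteq> carrier V) \<or>
     (carrier V \<subseteq> carrier X \<and> carrier W \<subseteq> carrier Y) \<or> (carrier V \<subseteq> carrier Y \<and> carrier W \<subseteq> carrier X)"
    using inter shared_P_Int(1)[OF XY VW eq(1)] shared_P_Int(1)[OF YX VW eq(3)]
      shared_P_Int(1)[OF VW XY eq(1)[symmetric]] shared_P_Int(1)[OF WV XY eq(2)[symmetric]]
    by blast
  then have "(carrier X = carrier V \<and> carrier Y = carrier W) \<or> (carrier X = carrier W \<and> carrier Y = carrier V)"
    using shared_P_Int(4)[OF XY VW eq(1)] shared_P_Int(4)[OF YX WV eq(4)]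
      shared_P_Int(4)[OF XY WV eq(2)] shared_P_Int(4)[OF YX VW eq(3)]
      shared_P_Int(4)[OF VW XY eq(1)[symmetric]] shared_P_Int(4)[OF WV YX eq(4)[symmetric]]
      shared_P_Int(4)[OF WV XY eq(2)[symmetric]] shared_P_Int(4)[OF VW YX eq(3)[symmetric]]
    by metis
  moreover have ideals: "banach_ideal U X" "banach_ideal U Y" "banach_ideal U V" "banach_ideal U W"
    using XY shared_P_Int(2)[OF XY VW eq(1)] shared_P_Int(2)[OF XY WV eq(2)] by (auto simp: ideal_pair_def)
  ultimately show ?thesis using lattice_equiv_if_same_carrier[of U] by blast
qed

end
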